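(* Let $\mathcal{H}_n$ be the Connes-Moscovici Hopf algebra and let $C$ be a cocommutative right $\mathcal{H}_n$-module coalgebra with non-trivial $\mathcal{H}_n$-action. Then there is no finite dimensional right Hopf Galois coextension $C(D)_{\mathcal{H}_n}$ (that is, if $C$ is finite dimensional, then $C(D)_{\mathcal{H}_n}$ is not a right Hopf Galois coextension).
   Context: An action is trivial if it is $ch=\varepsilon(h)c$. For a Hopf algebra $H$ and a right $H$-module coalgebra $C$, let $I=\mathrm{span}\{ch-\varepsilon(h)c\}$ (a coideal), $D=C/I$ the quotient coalgebra and $\pi\colon C\to D$ the projection, which makes $C$ a $D$-bicomodule. $C(D)_H$ is a (right) Hopf Galois coextension if $can\colon C\otimes H\to C\Box_D C$, $c\otimes h\mapsto c^{(1)}\otimes c^{(2)}h$, is bijective. The Connes-Moscovici Hopf algebra $\mathcal{H}_n$ (over $\mathbb{C}$) is the standard one: on the frame bundle $F\mathbb{R}^n$ with coordinates $(x^\mu,y^\mu_j)$, $y\in GL_n(\mathbb{R})$, put $X_k=y^\mu_k\partial/\partial x^\mu$, $Y_i^j=y_i^\mu\partial/\partial y_j^\mu$. On the crossed product $C_c^\infty(F\mathbb{R}^n)\rtimes \mathrm{Diff}(\mathbb{R}^n)$, spanned by elements $gU_\phi^*$, let $X_k(gU_\phi^* )=X_k(g)U_\phi^*$, $Y_i^j(gU_\phi^* )=Y_i^j(g)U_\phi^*$ and $\delta^i_{jk}(gU_\phi^* )=\gamma^i_{jk}(\phi)gU_\phi^*$ with $\gamma^i_{jk}(\phi)(x,y)=(y^{-1}\phi'(x)^{-1}\partial_\mu\phi'(x)\,y)^i_j\,y^\mu_k$.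 $\mathcal{H}_n$ is the algebra of linear operators generated by all $X_k,Y_i^j,\delta^i_{jk}$, with coproduct determined by $h(ab)=h^{(1)}(a)h^{(2)}(b)$ and counit by $h(1)=\varepsilon(h)1$. *)

theory Defs
  imports
    "HOL-Analysis.Analysis"
    "HOL-Algebra.Algebraic_Closure_Type"
    "Jordan_Normal_Form.Missing_VectorSpace"
begin

unbundle no fps_syntax

section \<open>Tensor products of vector spaces\<close>

text \<open>
  Vector spaces are carrier-based (\<open>vectorspace\<close> of the AFP entry VectorSpace, records of
  HOL-Algebra), because quotients by subspaces and algebras of operators occur as objects.
  The \<open>mult\<close> and \<open>one\<close> fields of a module record are irrelevant unless the space is an algebra.
\<close>

abbreviation scalars :: "'k::field ring" where
  "scalars \<equiv> ring_of_type_algebra"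

definition quotient_module ::
  "('k::field, 'a, 'm) module_scheme \<Rightarrow> 'a set \<Rightarrow> ('k, 'a set) module" where
  "quotient_module M N =
    \<lparr>carrier = a_rcosets\<^bsub>M\<^esub> N, monoid.mult = undefined, one = undefined,
     zero = N, add = (\<lambda>A B. A <+>\<^bsub>M\<^esub> B),
     smult = (\<lambda>a A. \<Union>x\<in>A. N +>\<^bsub>M\<^esub> (a \<odot>\<^bsub>M\<^esub> x))\<rparr>"

definition quotient_proj :: "('k::field, 'a, 'm) module_scheme \<Rightarrow> 'a set \<Rightarrow> 'a \<Rightarrow> 'a set" where
  "quotient_proj M N x = N +>\<^bsub>M\<^esub> x"

definition free_module :: "'x set \<Rightarrow> ('k::field, 'x \<Rightarrow> 'k) module" where
  "free_module S =
    \<lparr>carrier = {f. finite {x. f x \<noteq> 0} \<and> {x. f x \<noteq> 0} \<subseteq> S},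
     monoid.mult = undefined, one = undefined,
     zero = (\<lambda>_. 0), add = (\<lambda>f g x. f x + g x), smult = (\<lambda>a f x. a * f x)\<rparr>"

definition free_gen :: "'x \<Rightarrow> 'x \<Rightarrow> 'k::field" where
  "free_gen x = (\<lambda>y. if y = x then 1 else 0)"

definition bilinear_relations ::
  "('k::field, 'a, 'm) module_scheme \<Rightarrow> ('k, 'b, 'n) module_scheme \<Rightarrow> ('a \<times> 'b \<Rightarrow> 'k) set" where
  "bilinear_relations V W =
     {\<lambda>p. free_gen (v \<oplus>\<^bsub>V\<^esub> v', w) p - free_gen (v, w) p - free_gen (v', w) p | v v' w.
        v \<in> carrier V \<and> v' \<in> carrier V \<and> w \<in> carrier W}
   \<union> {\<lambda>p. free_gen (v, w \<oplus>\<^bsub>W\<^esub> w') p - free_gen (v, w) p - free_gen (v, w') p | v w w'.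
        v \<in> carrier V \<and> w \<in> carrier W \<and> w' \<in> carrier W}
   \<union> {\<lambda>p. free_gen (a \<odot>\<^bsub>V\<^esub> v, w) p - a * free_gen (v, w) p | a v w.
        v \<in> carrier V \<and> w \<in> carrier W}
   \<union> {\<lambda>p. free_gen (v, a \<odot>\<^bsub>W\<^esub> w) p - a * free_gen (v, w) p | a v w.
        v \<in> carrier V \<and> w \<in> carrier W}"

definition tensor_kernel ::
  "('k::field, 'a, 'm) module_scheme \<Rightarrow> ('k, 'b, 'n) module_scheme \<Rightarrow> ('a \<times> 'b \<Rightarrow> 'k) set" where
  "tensor_kernel V W =
     LinearCombinations.module.span scalars (free_module (carrier V \<times> carrier W))
       (bilinear_relations V W)"

definition tensor ::
  "('k::field, 'a, 'm) module_scheme \<Rightarrow> ('k, 'b, 'n) module_scheme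
    \<Rightarrow> ('k, ('a \<times> 'b \<Rightarrow> 'k) set) module" where
  "tensor V W = quotient_module (free_module (carrier V \<times> carrier W)) (tensor_kernel V W)"

definition tensor_elem ::
  "('k::field, 'a, 'm) module_scheme \<Rightarrow> ('k, 'b, 'n) module_scheme \<Rightarrow> 'a \<Rightarrow> 'b
    \<Rightarrow> ('a \<times> 'b \<Rightarrow> 'k) set" where
  "tensor_elem V W v w =
     quotient_proj (free_module (carrier V \<times> carrier W)) (tensor_kernel V W) (free_gen (v, w))"

text \<open>
  The linear map into \<open>U\<close> induced by a bilinear map \<open>B\<close>. It is evaluated on an arbitrary
  representative; for bilinear \<open>B\<close> the result does not depend on the choice.
\<close>

definition tensor_lift ::
  "('k::field, 'u, 'm) module_scheme \<Rightarrow> ('a \<Rightarrow> 'b \<Rightarrow> 'u) \<Rightarrow> ('a \<times> 'b \<Rightarrow> 'k) set \<Rightarrow> 'u" where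
  "tensor_lift U B t =
    (let f = (SOME f. f \<in> t) in
       (\<Oplus>\<^bsub>U\<^esub>p\<in>{p. f p \<noteq> 0}. f p \<odot>\<^bsub>U\<^esub> B (fst p) (snd p)))"

text \<open>\<open>tensor_map V W f g\<close> is \<open>f \<otimes> g\<close>; the spaces \<open>V\<close> and \<open>W\<close> are the \<^emph>\<open>codomains\<close> of
  \<open>f\<close> and \<open>g\<close>.\<close>

definition tensor_map ::
  "('k::field, 'c, 'm) module_scheme \<Rightarrow> ('k, 'd, 'n) module_scheme
    \<Rightarrow> ('a \<Rightarrow> 'c) \<Rightarrow> ('b \<Rightarrow> 'd) \<Rightarrow> ('a \<times> 'b \<Rightarrow> 'k) set \<Rightarrow> ('c \<times> 'd \<Rightarrow> 'k) set" where
  "tensor_map V W f g = tensor_lift (tensor V W) (\<lambda>a b. tensor_elem V W (f a) (g b))"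

definition tensor_swap ::
  "('k::field, 'a, 'm) module_scheme \<Rightarrow> ('k, 'b, 'n) module_scheme
    \<Rightarrow> ('a \<times> 'b \<Rightarrow> 'k) set \<Rightarrow> ('b \<times> 'a \<Rightarrow> 'k) set" where
  "tensor_swap V W = tensor_lift (tensor W V) (\<lambda>v w. tensor_elem W V w v)"

text \<open>The canonical map \<open>(U \<otimes> V) \<otimes> W \<rightarrow> U \<otimes> (V \<otimes> W)\<close>.\<close>

definition tensor_assoc ::
  "('k::field, 'a, 'l) module_scheme \<Rightarrow> ('k, 'b, 'm) module_scheme \<Rightarrow> ('k, 'c, 'n) module_scheme
    \<Rightarrow> (('a \<times> 'b \<Rightarrow> 'k) set \<times> 'c \<Rightarrow> 'k) set \<Rightarrow> ('a \<times> ('b \<times> 'c \<Rightarrow> 'k) set \<Rightarrow> 'k) set" where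
  "tensor_assoc U V W =
     tensor_lift (tensor U (tensor V W))
       (\<lambda>s w. tensor_lift (tensor U (tensor V W))
                (\<lambda>u v. tensor_elem U (tensor V W) u (tensor_elem V W v w)) s)"


section \<open>Coalgebras, module coalgebras and Hopf Galois coextensions\<close>

text \<open>
  The same record carries the data of a bialgebra, with product and unit in the fields
  \<open>mult\<close> and \<open>one\<close>.
\<close>

record ('k, 'a) coalgebra = "('k, 'a) module" +
  comult :: "'a \<Rightarrow> ('a \<times> 'a \<Rightarrow> 'k) set"
  counit :: "'a \<Rightarrow> 'k"

locale coalgebra = vectorspace scalars C
  for C :: "('k::field, 'a, 'm) coalgebra_scheme" (structure) +
  assumes comult_linear: "comult C \<in> module_hom scalars C (tensor C C)"
    and counit_add: "\<lbrakk>a \<in> carrier C; b \<in> carrier C\<rbrakk>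
          \<Longrightarrow> counit C (a \<oplus> b) = counit C a + counit C b"
    and counit_smult: "a \<in> carrier C \<Longrightarrow> counit C (r \<odot> a) = r * counit C a"
    and coassoc: "a \<in> carrier C \<Longrightarrow>
          tensor_assoc C C C (tensor_map (tensor C C) C (comult C) (\<lambda>x. x) (comult C a))
            = tensor_map C (tensor C C) (\<lambda>x. x) (comult C) (comult C a)"
    and counit_left: "a \<in> carrier C \<Longrightarrow> tensor_lift C (\<lambda>x y. counit C x \<odot> y) (comult C a) = a"
    and counit_right: "a \<in> carrier C \<Longrightarrow> tensor_lift C (\<lambda>x y. counit C y \<odot> x) (comult C a) = a"

definition cocommutative :: "('k::field, 'a, 'm) coalgebra_scheme \<Rightarrow> bool" where
  "cocommutative C \<longleftrightarrow> (\<forall>c\<in>carrier C. tensor_swap C C (comult C c) = comult C c)"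

locale right_module_coalgebra = coalgebra C
  for H :: "('k::field, 'h, 'n) coalgebra_scheme"
    and C :: "('k, 'a, 'm) coalgebra_scheme"
    and act :: "'a \<Rightarrow> 'h \<Rightarrow> 'a" +
  assumes act_closed: "\<lbrakk>c \<in> carrier C; h \<in> carrier H\<rbrakk> \<Longrightarrow> act c h \<in> carrier C"
    and act_add_left: "\<lbrakk>c \<in> carrier C; d \<in> carrier C; h \<in> carrier H\<rbrakk>
          \<Longrightarrow> act (c \<oplus>\<^bsub>C\<^esub> d) h = act c h \<oplus>\<^bsub>C\<^esub> act d h"
    and act_smult_left: "\<lbrakk>c \<in> carrier C; h \<in> carrier H\<rbrakk>
          \<Longrightarrow> act (r \<odot>\<^bsub>C\<^esub> c) h = r \<odot>\<^bsub>C\<^esub> act c h"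
    and act_add_right: "\<lbrakk>c \<in> carrier C; h \<in> carrier H; k \<in> carrier H\<rbrakk>
          \<Longrightarrow> act c (h \<oplus>\<^bsub>H\<^esub> k) = act c h \<oplus>\<^bsub>C\<^esub> act c k"
    and act_smult_right: "\<lbrakk>c \<in> carrier C; h \<in> carrier H\<rbrakk>
          \<Longrightarrow> act c (r \<odot>\<^bsub>H\<^esub> h) = r \<odot>\<^bsub>C\<^esub> act c h"
    and act_one: "c \<in> carrier C \<Longrightarrow> act c \<one>\<^bsub>H\<^esub> = c"
    and act_mult: "\<lbrakk>c \<in> carrier C; h \<in> carrier H; k \<in> carrier H\<rbrakk>
          \<Longrightarrow> act c (h \<otimes>\<^bsub>H\<^esub> k) = act (act c h) k"
    and comult_act: "\<lbrakk>c \<in> carrier C; h \<in> carrier H\<rbrakk> \<Longrightarrow>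
          comult C (act c h) =
            tensor_lift (tensor C C)
              (\<lambda>a b. tensor_lift (tensor C C)
                       (\<lambda>k l. tensor_elem C C (act a k) (act b l)) (comult H h))
              (comult C c)"
    and counit_act: "\<lbrakk>c \<in> carrier C; h \<in> carrier H\<rbrakk>
          \<Longrightarrow> counit C (act c h) = counit C c * counit H h"

definition trivial_action ::
  "('k::field, 'h, 'n) coalgebra_scheme \<Rightarrow> ('k, 'a, 'm) coalgebra_scheme
    \<Rightarrow> ('a \<Rightarrow> 'h \<Rightarrow> 'a) \<Rightarrow> bool" where
  "trivial_action H C act \<longleftrightarrow>
     (\<forall>c\<in>carrier C. \<forall>h\<in>carrier H. act c h = counit H h \<odot>\<^bsub>C\<^esub> c)"

definition action_coideal ::
  "('k::field, 'h, 'n) coalgebra_scheme \<Rightarrow> ('k, 'a, 'm) coalgebra_scheme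
    \<Rightarrow> ('a \<Rightarrow> 'h \<Rightarrow> 'a) \<Rightarrow> 'a set" where
  "action_coideal H C act =
     LinearCombinations.module.span scalars C
       {act c h \<ominus>\<^bsub>C\<^esub> (counit H h \<odot>\<^bsub>C\<^esub> c) | c h. c \<in> carrier C \<and> h \<in> carrier H}"

text \<open>The structure maps are evaluated on arbitrary representatives; for a coideal \<open>I\<close> the
  result does not depend on the choice.\<close>

definition quotient_coalgebra ::
  "('k::field, 'a, 'm) coalgebra_scheme \<Rightarrow> 'a set \<Rightarrow> ('k, 'a set) coalgebra" where
  "quotient_coalgebra C I =
     module.extend (quotient_module C I)
       (coalgebra.fields
         (\<lambda>A. tensor_map (quotient_module C I) (quotient_module C I)
                (quotient_proj C I) (quotient_proj C I) (comult C (SOME c. c \<in> A)))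
         (\<lambda>A. counit C (SOME c. c \<in> A)))"

text \<open>\<open>M \<box>\<^sub>D N\<close> for a right coaction \<open>\<rho> : M \<rightarrow> M \<otimes> D\<close> and a left coaction
  \<open>\<lambda> : N \<rightarrow> D \<otimes> N\<close>.\<close>

definition cotensor ::
  "('k::field, 'a, 'l) module_scheme \<Rightarrow> ('k, 'd, 'm) module_scheme \<Rightarrow> ('k, 'b, 'n) module_scheme
    \<Rightarrow> ('a \<Rightarrow> ('a \<times> 'd \<Rightarrow> 'k) set) \<Rightarrow> ('b \<Rightarrow> ('d \<times> 'b \<Rightarrow> 'k) set) \<Rightarrow> ('a \<times> 'b \<Rightarrow> 'k) set set" where
  "cotensor M D N \<rho> lam =
     {t \<in> carrier (tensor M N).
        tensor_assoc M D N (tensor_map (tensor M D) N \<rho> (\<lambda>x. x) t)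
          = tensor_map M (tensor D N) (\<lambda>x. x) lam t}"

definition galois_can ::
  "('k::field, 'a, 'm) coalgebra_scheme \<Rightarrow> ('a \<Rightarrow> 'h \<Rightarrow> 'a)
    \<Rightarrow> ('a \<times> 'h \<Rightarrow> 'k) set \<Rightarrow> ('a \<times> 'a \<Rightarrow> 'k) set" where
  "galois_can C act =
     tensor_lift (tensor C C) (\<lambda>c h. tensor_map C C (\<lambda>x. x) (\<lambda>y. act y h) (comult C c))"

definition hopf_galois_coextension ::
  "('k::field, 'h, 'n) coalgebra_scheme \<Rightarrow> ('k, 'a, 'm) coalgebra_scheme
    \<Rightarrow> ('a \<Rightarrow> 'h \<Rightarrow> 'a) \<Rightarrow> bool" where
  "hopf_galois_coextension H C act \<longleftrightarrow>
    (let I = action_coideal H C act;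
         D = quotient_coalgebra C I;
         \<pi> = quotient_proj C I
     in bij_betw (galois_can C act) (carrier (tensor C H))
          (cotensor C D C
             (\<lambda>c. tensor_map C D (\<lambda>x. x) \<pi> (comult C c))
             (\<lambda>c. tensor_map D C \<pi> (\<lambda>x. x) (comult C c))))"


section \<open>The Connes--Moscovici Hopf algebra\<close>

primrec C_k :: "nat \<Rightarrow> ('a::euclidean_space \<Rightarrow> 'b::real_normed_vector) \<Rightarrow> bool" where
  "C_k 0 f \<longleftrightarrow> continuous_on UNIV f"
| "C_k (Suc m) f \<longleftrightarrow> (\<forall>x. f differentiable (at x)) \<and>
     (\<forall>v. C_k m (\<lambda>x. frechet_derivative f (at x) v))"

definition smooth :: "('a::euclidean_space \<Rightarrow> 'b::real_normed_vector) \<Rightarrow> bool" where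
  "smooth f \<longleftrightarrow> (\<forall>m. C_k m f)"

definition diffeomorphisms :: "('a::euclidean_space \<Rightarrow> 'a) set" where
  "diffeomorphisms = {\<phi>. bij \<phi> \<and> smooth \<phi> \<and> smooth (inv_into UNIV \<phi>)}"

text \<open>
  Points of the frame bundle are pairs \<open>(x, y)\<close> with \<open>y \<in> GL\<^sub>n\<close> and \<open>y\<^sup>\<mu>\<^sub>j = y $ \<mu> $ j\<close>.
  A test function on it is represented by its extension by zero to all pairs \<open>(x, y)\<close>.
\<close>

type_synonym 'n frame = "(real ^ 'n) \<times> (real ^ 'n ^ 'n)"

definition frame_bundle :: "'n::finite frame set" where
  "frame_bundle = {(x, y). invertible y}"

definition test_functions :: "('n::finite frame \<Rightarrow> complex) set" where
  "test_functions =
     {f. smooth f \<and> (\<exists>K. compact K \<and> K \<subseteq> frame_bundle \<and> (\<forall>p. p \<notin> K \<longrightarrow> f p = 0))}"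

definition frame_lift :: "(real ^ 'n \<Rightarrow> real ^ 'n) \<Rightarrow> 'n::finite frame \<Rightarrow> 'n frame" where
  "frame_lift \<phi> = (\<lambda>(x, y). (\<phi> x, jacobian \<phi> (at x) ** y))"

text \<open>
  An element \<open>\<Sum>\<^sub>\<phi> f\<^sub>\<phi> U\<^sub>\<phi>\<^sup>*\<close> of the crossed product is the family \<open>\<phi> \<mapsto> f\<^sub>\<phi>\<close>. The product is
  \<open>(f U\<^sub>\<phi>\<^sup>*) (g U\<^sub>\<psi>\<^sup>*) = f \<cdot> (g \<circ> \<phi>') U\<^sub>\<psi>\<^sub>\<phi>\<^sup>*\<close> with \<open>\<phi>' = frame_lift \<phi>\<close>. The algebra has no unit,
  so the \<open>one\<close> field is left unspecified.
\<close>

type_synonym 'n crossed = "(real ^ 'n \<Rightarrow> real ^ 'n) \<Rightarrow> 'n frame \<Rightarrow> complex"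

definition crossed_elem :: "('n::finite frame \<Rightarrow> complex) \<Rightarrow> (real ^ 'n \<Rightarrow> real ^ 'n) \<Rightarrow> 'n crossed"
  where "crossed_elem f \<phi> = (\<lambda>\<eta>. if \<eta> = \<phi> then f else (\<lambda>_. 0))"

definition crossed_product :: "(complex, 'n::finite crossed) module" where
  "crossed_product =
    \<lparr>carrier = {a. finite {\<phi>. a \<phi> \<noteq> (\<lambda>_. 0)} \<and> {\<phi>. a \<phi> \<noteq> (\<lambda>_. 0)} \<subseteq> diffeomorphisms
                  \<and> (\<forall>\<phi>. a \<phi> \<in> test_functions)},
     monoid.mult = (\<lambda>a b \<eta> p.
       \<Sum>(\<phi>, \<psi>)\<in>{(\<phi>, \<psi>). a \<phi> \<noteq> (\<lambda>_. 0) \<and> b \<psi> \<noteq> (\<lambda>_. 0) \<and> \<psi> \<circ> \<phi> = \<eta>}.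
         a \<phi> p * b \<psi> (frame_lift \<phi> p)),
     one = undefined,
     zero = (\<lambda>_ _. 0),
     add = (\<lambda>a b \<phi> p. a \<phi> p + b \<phi> p),
     smult = (\<lambda>r a \<phi> p. r * a \<phi> p)\<rparr>"

definition X_field :: "'n \<Rightarrow> ('n::finite frame \<Rightarrow> complex) \<Rightarrow> 'n frame \<Rightarrow> complex" where
  "X_field k g = (\<lambda>(x, y).
     \<Sum>\<mu>\<in>UNIV. complex_of_real (y $ \<mu> $ k) * frechet_derivative g (at (x, y)) (axis \<mu> 1, 0))"

text \<open>\<open>Y_field i j\<close> is \<open>Y\<^sub>i\<^sup>j = y\<^sub>i\<^sup>\<mu> \<partial>/\<partial>y\<^sub>j\<^sup>\<mu>\<close>; the matrix unit \<open>axis \<mu> (axis j 1)\<close> has its entry in row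
  \<open>\<mu>\<close> and column \<open>j\<close>.\<close>

definition Y_field :: "'n \<Rightarrow> 'n \<Rightarrow> ('n::finite frame \<Rightarrow> complex) \<Rightarrow> 'n frame \<Rightarrow> complex" where
  "Y_field i j g = (\<lambda>(x, y).
     \<Sum>\<mu>\<in>UNIV. complex_of_real (y $ \<mu> $ i)
       * frechet_derivative g (at (x, y)) (0, axis \<mu> (axis j 1)))"

text \<open>\<open>cm_gamma i j k \<phi>\<close> is \<open>\<gamma>\<^sup>i\<^sub>j\<^sub>k(\<phi>)\<close>.\<close>

definition cm_gamma :: "'n \<Rightarrow> 'n \<Rightarrow> 'n \<Rightarrow> (real ^ 'n \<Rightarrow> real ^ 'n) \<Rightarrow> 'n::finite frame \<Rightarrow> real" where
  "cm_gamma i j k \<phi> = (\<lambda>(x, y).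
     \<Sum>\<mu>\<in>UNIV.
       (matrix_inv y ** matrix_inv (jacobian \<phi> (at x))
          ** frechet_derivative (\<lambda>z. jacobian \<phi> (at z)) (at x) (axis \<mu> 1) ** y) $ i $ j
       * y $ \<mu> $ k)"

text \<open>
  The linear operator on the crossed product given by \<open>g U\<^sub>\<phi>\<^sup>* \<mapsto> F \<phi> g U\<^sub>\<phi>\<^sup>*\<close>. Operators take the value
  \<open>0\<close> outside the carrier, so that equality of HOL functions is equality of operators.
\<close>

definition crossed_operator ::
  "((real ^ 'n \<Rightarrow> real ^ 'n) \<Rightarrow> ('n frame \<Rightarrow> complex) \<Rightarrow> 'n frame \<Rightarrow> complex)
    \<Rightarrow> 'n::finite crossed \<Rightarrow> 'n crossed" where
  "crossed_operator F =
     (\<lambda>a. if a \<in> carrier crossed_product then (\<lambda>\<phi>. F \<phi> (a \<phi>)) else (\<lambda>_ _. 0))"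

type_synonym 'n cm_op = "'n crossed \<Rightarrow> 'n crossed"

definition cm_id :: "'n::finite cm_op" where
  "cm_id = crossed_operator (\<lambda>\<phi> g. g)"

definition cm_X :: "'n \<Rightarrow> 'n::finite cm_op" where
  "cm_X k = crossed_operator (\<lambda>\<phi>. X_field k)"

definition cm_Y :: "'n \<Rightarrow> 'n \<Rightarrow> 'n::finite cm_op" where
  "cm_Y i j = crossed_operator (\<lambda>\<phi>. Y_field i j)"

definition cm_delta :: "'n \<Rightarrow> 'n \<Rightarrow> 'n \<Rightarrow> 'n::finite cm_op" where
  "cm_delta i j k = crossed_operator (\<lambda>\<phi> g p. complex_of_real (cm_gamma i j k \<phi> p) * g p)"

inductive_set cm_operators :: "'n::finite cm_op set" where
  id: "cm_id \<in> cm_operators"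
| gen_X: "cm_X k \<in> cm_operators"
| gen_Y: "cm_Y i j \<in> cm_operators"
| gen_delta: "cm_delta i j k \<in> cm_operators"
| add: "\<lbrakk>S \<in> cm_operators; T \<in> cm_operators\<rbrakk> \<Longrightarrow> (\<lambda>a \<phi> p. S a \<phi> p + T a \<phi> p) \<in> cm_operators"
| smult: "T \<in> cm_operators \<Longrightarrow> (\<lambda>a \<phi> p. r * T a \<phi> p) \<in> cm_operators"
| comp: "\<lbrakk>S \<in> cm_operators; T \<in> cm_operators\<rbrakk> \<Longrightarrow> S \<circ> T \<in> cm_operators"

definition cm_algebra :: "(complex, 'n::finite cm_op) module" where
  "cm_algebra =
    \<lparr>carrier = cm_operators, monoid.mult = (\<lambda>S T. S \<circ> T), one = cm_id,
     zero = (\<lambda>_ _ _. 0), add = (\<lambda>S T a \<phi> p. S a \<phi> p + T a \<phi> p),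
     smult = (\<lambda>r T a \<phi> p. r * T a \<phi> p)\<rparr>"

text \<open>
  The coproduct of \<open>h\<close> is the tensor characterised by \<open>h(ab) = h\<^sup>(\<^sup>1\<^sup>)(a) h\<^sup>(\<^sup>2\<^sup>)(b)\<close> on the crossed
  product.
\<close>

definition cm_comult :: "'n::finite cm_op \<Rightarrow> ('n cm_op \<times> 'n cm_op \<Rightarrow> complex) set" where
  "cm_comult h =
    (THE t. t \<in> carrier (tensor cm_algebra cm_algebra) \<and>
       (\<forall>a\<in>carrier crossed_product. \<forall>b\<in>carrier crossed_product.
          h (a \<otimes>\<^bsub>crossed_product\<^esub> b)
            = tensor_lift crossed_product
                (\<lambda>k l. k a \<otimes>\<^bsub>crossed_product\<^esub> l b) t))"

text \<open>
  The constant function \<open>1\<close> is not compactly supported. Operators generated by \<open>X\<close>, \<open>Y\<close> and \<open>\<delta>\<close> are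
  local, so \<open>h(1) = \<epsilon>(h) 1\<close> means that, on every open set where a test function \<open>f\<close> equals \<open>1\<close>,
  \<open>h(f U\<^sub>i\<^sub>d\<^sup>*)\<close> agrees with \<open>\<epsilon>(h) 1\<close>, where \<open>1 = 1 U\<^sub>i\<^sub>d\<^sup>*\<close>.
\<close>

definition cm_counit :: "'n::finite cm_op \<Rightarrow> complex" where
  "cm_counit h =
    (THE e. \<forall>f\<in>test_functions. \<forall>S. open S \<and> (\<forall>p\<in>S. f p = 1) \<longrightarrow>
       (\<forall>p\<in>S. \<forall>\<phi>. h (crossed_elem f (\<lambda>x. x)) \<phi> p = e * crossed_elem (\<lambda>_. 1) (\<lambda>x. x) \<phi> p))"

definition cm_hopf_algebra :: "(complex, 'n::finite cm_op) coalgebra" where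
  "cm_hopf_algebra = module.extend cm_algebra (coalgebra.fields cm_comult cm_counit)"

end

theory Submission
  imports Defs
begin

text \<open>
  The canonical map \<open>C \<otimes> \<H>\<^sub>n \<rightarrow> C \<box>\<^sub>D C\<close> cannot be injective for dimension reasons: \<open>\<H>\<^sub>n\<close> is infinite
  dimensional, so for \<open>C \<noteq> 0\<close> the source is infinite dimensional, while the target lies in the finite
  dimensional space \<open>C \<otimes> C\<close>. A nontrivial action forces \<open>C \<noteq> 0\<close>.

  The proof makes the kernel explicit. Since \<open>End(C)\<close> is finite dimensional, some nonzero \<open>h \<in> \<H>\<^sub>n\<close> acts on
  \<open>C\<close> as zero. For \<open>c \<noteq> 0\<close> the tensor \<open>c \<otimes> h\<close> is then a nonzero element that the canonical map sends to
  \<open>c\<^sup>(\<^sup>1\<^sup>) \<otimes> c\<^sup>(\<^sup>2\<^sup>)h = 0\<close> (\<open>not_hopf_galois_coextension_if_annihilator\<close>). This step needs that the lifts of bilinear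
  maps to the tensor product, which are defined through arbitrary representatives, are well
  defined and linear (\<open>tensor_lift_quotient_proj\<close>, \<open>tensor_lift_hom\<close>).

  The element \<open>h\<close> is a product of polynomials in one horizontal field \<open>X\<^sub>k\<close>. For a single \<open>c\<close>, the vectors
  \<open>c X\<^sub>k\<^sup>i\<close> are linearly dependent, which gives a polynomial \<open>q \<noteq> 0\<close> with \<open>c q(X\<^sub>k) = 0\<close>; treating the members
  of a finite generating set one after another gives an \<open>h\<close> that annihilates all of \<open>C\<close>
  (\<open>ex_faithful_operator_annihilating\<close>).

  What keeps \<open>h\<close> from being zero is that \<open>q(X\<^sub>k)\<close> is injective on the crossed product (\<open>cm_X_poly_inj\<close>):
  \<open>q\<close> is a product of linear factors over \<open>\<complex>\<close>, and \<open>X\<^sub>k - z\<close> has no kernel, because along the integral lines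
  of \<open>X\<^sub>k\<close> an eigenfunction is an exponential, which cannot have compact support unless it vanishes
  (\<open>X_field_no_eigenfunction\<close>). It remains to see that the crossed product itself is not zero, that
  is, that nonzero smooth functions with compact support exist (\<open>smooth_bump_function\<close>).
\<close>

section \<open>Quotients and free vector spaces\<close>

lemma scalars_simps [simp]:
  "carrier scalars = UNIV" "\<zero>\<^bsub>scalars\<^esub> = 0" "\<one>\<^bsub>scalars\<^esub> = 1"
  "a \<oplus>\<^bsub>scalars\<^esub> b = a + b" "a \<otimes>\<^bsub>scalars\<^esub> b = a * b"
  by (simp_all add: ring_of_type_algebra_def)

lemma cring_scalars: "cring (scalars :: 'k::field ring)"
  by (rule cring_from_type_algebra)

lemma free_module_simps [simp]:
  "carrier (free_module S) = {f. finite {x. f x \<noteq> 0} \<and> {x. f x \<noteq> 0} \<subseteq> S}"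
  "\<zero>\<^bsub>free_module S\<^esub> = (\<lambda>_. 0)"
  "f \<oplus>\<^bsub>free_module S\<^esub> g = (\<lambda>x. f x + g x)"
  "a \<odot>\<^bsub>free_module S\<^esub> f = (\<lambda>x. a * f x)"
  by (simp_all add: free_module_def)

lemma module_free_module: "module scalars (free_module S :: ('k::field, 'x \<Rightarrow> 'k) module)"
proof (rule module_criteria[OF cring_scalars])
  show "\<forall>v\<in>carrier (free_module S :: ('k, 'x \<Rightarrow> 'k) module). \<exists>neg_v\<in>carrier (free_module S).
      v \<oplus>\<^bsub>free_module S\<^esub> neg_v = \<zero>\<^bsub>free_module S\<^esub>"
  proof
    fix v :: "'x \<Rightarrow> 'k"
    assume "v \<in> carrier (free_module S)"
    then show "\<exists>w\<in>carrier (free_module S). v \<oplus>\<^bsub>free_module S\<^esub> w = \<zero>\<^bsub>free_module S\<^esub>"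
      by (intro bexI[of _ "\<lambda>x. - v x"]) auto
  qed
  show "\<forall>v w. v \<in> carrier (free_module S :: ('k, 'x \<Rightarrow> 'k) module) \<and> w \<in> carrier (free_module S)
      \<longrightarrow> v \<oplus>\<^bsub>free_module S\<^esub> w \<in> carrier (free_module S)"
  proof (intro allI impI)
    fix v w :: "'x \<Rightarrow> 'k"
    assume vw: "v \<in> carrier (free_module S) \<and> w \<in> carrier (free_module S)"
    have "{x. v x + w x \<noteq> 0} \<subseteq> {x. v x \<noteq> 0} \<union> {x. w x \<noteq> 0}"
      by auto
    with vw show "v \<oplus>\<^bsub>free_module S\<^esub> w \<in> carrier (free_module S)"
      using finite_subset[of "{x. v x + w x \<noteq> 0}"] by simp blast
  qed
  show "\<forall>c v. c \<in> carrier scalars \<and> v \<in> carrier (free_module S :: ('k, 'x \<Rightarrow> 'k) module)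
      \<longrightarrow> c \<odot>\<^bsub>free_module S\<^esub> v \<in> carrier (free_module S)"
    by (auto simp: Collect_mono_iff)
qed (simp_all add: algebra_simps)

lemma free_gen_in_free_module: "x \<in> S \<Longrightarrow> (free_gen x :: 'x \<Rightarrow> 'k::field) \<in> carrier (free_module S)"
proof -
  have "{y. free_gen x y \<noteq> (0::'k)} = {x}" by (auto simp: free_gen_def)
  then show "x \<in> S \<Longrightarrow> (free_gen x :: _ \<Rightarrow> 'k) \<in> carrier (free_module S)" by simp
qed

text \<open>Every coset is the image of an element under the projection, so each module axiom for the
  quotient is the projection of the same axiom upstairs, once the projection is known to be linear.\<close>

lemma quotient_carrier:
  "carrier (quotient_module M N) = quotient_proj M N ` carrier M"
  by (auto simp: quotient_module_def quotient_proj_def A_RCOSETS_def')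

context
  fixes M :: "('k::field, 'a, 'm) module_scheme" and N
  assumes modM: "module scalars M" and subN: "submodule scalars N M"
begin

interpretation M: module scalars M by (rule modM)
interpretation N: submodule scalars N M by (rule subN)

lemma submodule_abelian_subgroup: "abelian_subgroup N M"
proof (rule abelian_subgroupI3[OF _ M.abelian_group_axioms])
  have "\<ominus>\<^bsub>M\<^esub> x \<in> N" if "x \<in> N" for x
  proof -
    have "\<ominus>\<^bsub>M\<^esub> x = (\<ominus>\<^bsub>scalars\<^esub> \<one>\<^bsub>scalars\<^esub>) \<odot>\<^bsub>M\<^esub> x"
      using that N.subset by (metis M.smult_minus_1 subsetD)
    then show ?thesis using N.smult_closed[OF _ that] by simp
  qed
  moreover have "N \<noteq> {}"
    using N.zero_closed by blast
  ultimately show "additive_subgroup N M"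
    by (intro additive_subgroup.intro M.add.subgroupI)
      (use N.subset in \<open>auto simp flip: a_inv_def\<close>)
qed

interpretation N: abelian_subgroup N M by (rule submodule_abelian_subgroup)

lemma quotient_proj_add:
  assumes "x \<in> carrier M" "y \<in> carrier M"
  shows "quotient_proj M N (x \<oplus>\<^bsub>M\<^esub> y)
    = quotient_proj M N x \<oplus>\<^bsub>quotient_module M N\<^esub> quotient_proj M N y"
  using N.a_rcos_sum[OF assms] by (simp add: quotient_module_def quotient_proj_def)

lemma quotient_proj_eqI:
  assumes "y \<in> quotient_proj M N x" "x \<in> carrier M"
  shows "quotient_proj M N y = quotient_proj M N x"
  using M.a_repr_independence[OF _ assms(2) N.a_subgroup] assms(1)
  by (simp add: quotient_proj_def)

lemma quotient_proj_mem:
  "y \<in> quotient_proj M N x \<longleftrightarrow> (\<exists>n\<in>N. y = n \<oplus>\<^bsub>M\<^esub> x)"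
  by (auto simp: quotient_proj_def a_r_coset_def')

lemma quotient_proj_self: "x \<in> carrier M \<Longrightarrow> x \<in> quotient_proj M N x"
  by (auto simp: quotient_proj_mem intro!: bexI[of _ "\<zero>\<^bsub>M\<^esub>"])

text \<open>The scalar multiple of a coset is a union over all its representatives. Two representatives
  differ by an element of the submodule, and so do their multiples: all members of the union
  coincide.\<close>

lemma quotient_proj_smult:
  assumes "x \<in> carrier M"
  shows "quotient_proj M N (a \<odot>\<^bsub>M\<^esub> x) = a \<odot>\<^bsub>quotient_module M N\<^esub> quotient_proj M N x"
proof -
  have *: "quotient_proj M N (a \<odot>\<^bsub>M\<^esub> y) = quotient_proj M N (a \<odot>\<^bsub>M\<^esub> x)"
    if "y \<in> quotient_proj M N x" for y
  proof (rule quotient_proj_eqI)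
    from that obtain n where n: "n \<in> N" "y = n \<oplus>\<^bsub>M\<^esub> x" by (auto simp: quotient_proj_mem)
    then have "a \<odot>\<^bsub>M\<^esub> y = a \<odot>\<^bsub>M\<^esub> n \<oplus>\<^bsub>M\<^esub> a \<odot>\<^bsub>M\<^esub> x"
      using N.subset assms by (auto simp: M.smult_r_distr)
    then show "a \<odot>\<^bsub>M\<^esub> y \<in> quotient_proj M N (a \<odot>\<^bsub>M\<^esub> x)"
      using n by (auto simp: quotient_proj_mem)
  qed (use assms in auto)
  have "(\<Union>y\<in>quotient_proj M N x. quotient_proj M N (a \<odot>\<^bsub>M\<^esub> y))
      = (\<Union>y\<in>quotient_proj M N x. quotient_proj M N (a \<odot>\<^bsub>M\<^esub> x))"
    by (rule SUP_cong[OF refl *])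
  also have "\<dots> = quotient_proj M N (a \<odot>\<^bsub>M\<^esub> x)"
    using quotient_proj_self[OF assms] by blast
  finally show ?thesis
    by (simp add: quotient_module_def quotient_proj_def)
qed

lemma quotient_proj_zero: "quotient_proj M N \<zero>\<^bsub>M\<^esub> = \<zero>\<^bsub>quotient_module M N\<^esub>"
  using N.subset by (simp add: quotient_proj_def quotient_module_def)

lemma module_quotient_module: "module scalars (quotient_module M N)"
proof (rule module_criteria[OF cring_scalars])
  show "\<forall>A\<in>carrier (quotient_module M N). \<exists>B\<in>carrier (quotient_module M N).
      A \<oplus>\<^bsub>quotient_module M N\<^esub> B = \<zero>\<^bsub>quotient_module M N\<^esub>"
  proof
    fix A assume "A \<in> carrier (quotient_module M N)"
    then obtain x where x: "x \<in> carrier M" "A = quotient_proj M N x"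
      by (auto simp: quotient_carrier)
    then have "A \<oplus>\<^bsub>quotient_module M N\<^esub> quotient_proj M N (\<ominus>\<^bsub>M\<^esub> x) = \<zero>\<^bsub>quotient_module M N\<^esub>"
      by (simp add: M.r_neg flip: quotient_proj_add quotient_proj_zero)
    with x(1) show "\<exists>B\<in>carrier (quotient_module M N).
        A \<oplus>\<^bsub>quotient_module M N\<^esub> B = \<zero>\<^bsub>quotient_module M N\<^esub>"
      by (auto simp: quotient_carrier)
  qed
qed (auto simp: quotient_carrier M.a_ac M.smult_l_distr[simplified] M.smult_r_distr
        M.smult_assoc1[simplified] M.smult_one[simplified]
      simp flip: quotient_proj_add quotient_proj_smult quotient_proj_zero)

end

section \<open>The universal property of the tensor product\<close>

lemma scalars_uminus [simp]: "\<ominus>\<^bsub>scalars\<^esub> a = - a"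
proof -
  interpret cring "scalars :: 'a ring" by (rule cring_scalars)
  show ?thesis using minus_equality[of "- a" a] by simp
qed

locale bilinear_map = V: module scalars V + W: module scalars W + U: module scalars U
  for V :: "('k::field, 'a, 'l) module_scheme"
    and W :: "('k, 'b, 'm) module_scheme"
    and U :: "('k, 'c, 'n) module_scheme" +
  fixes B :: "'a \<Rightarrow> 'b \<Rightarrow> 'c"
  assumes closed [simp]: "\<lbrakk>v \<in> carrier V; w \<in> carrier W\<rbrakk> \<Longrightarrow> B v w \<in> carrier U"
    and add_left: "\<lbrakk>v \<in> carrier V; v' \<in> carrier V; w \<in> carrier W\<rbrakk>
      \<Longrightarrow> B (v \<oplus>\<^bsub>V\<^esub> v') w = B v w \<oplus>\<^bsub>U\<^esub> B v' w"
    and add_right: "\<lbrakk>v \<in> carrier V; w \<in> carrier W; w' \<in> carrier W\<rbrakk>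
      \<Longrightarrow> B v (w \<oplus>\<^bsub>W\<^esub> w') = B v w \<oplus>\<^bsub>U\<^esub> B v w'"
    and smult_left: "\<lbrakk>v \<in> carrier V; w \<in> carrier W\<rbrakk> \<Longrightarrow> B (a \<odot>\<^bsub>V\<^esub> v) w = a \<odot>\<^bsub>U\<^esub> B v w"
    and smult_right: "\<lbrakk>v \<in> carrier V; w \<in> carrier W\<rbrakk> \<Longrightarrow> B v (a \<odot>\<^bsub>W\<^esub> w) = a \<odot>\<^bsub>U\<^esub> B v w"
begin

text \<open>The tensor product is a quotient of the free space on pairs. A bilinear map is evaluated on it
  through its linear extension to that free space, which depends on the coset only because it
  kills the bilinear relations.\<close>

abbreviation F :: "('k, 'a \<times> 'b \<Rightarrow> 'k) module" where
  "F \<equiv> free_module (carrier V \<times> carrier W)"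

definition linear_extension :: "('a \<times> 'b \<Rightarrow> 'k) \<Rightarrow> 'c" where
  "linear_extension f = (\<Oplus>\<^bsub>U\<^esub>p\<in>{p. f p \<noteq> 0}. f p \<odot>\<^bsub>U\<^esub> B (fst p) (snd p))"

text \<open>Supports of two functions differ, so sums over supports can only be compared after both have
  been extended to a common finite set.\<close>

lemma linear_extension_superset:
  assumes "finite A" "{p. f p \<noteq> 0} \<subseteq> A" "A \<subseteq> carrier V \<times> carrier W"
  shows "linear_extension f = (\<Oplus>\<^bsub>U\<^esub>p\<in>A. f p \<odot>\<^bsub>U\<^esub> B (fst p) (snd p))"
  unfolding linear_extension_def
proof (rule U.add.finprod_mono_neutral_cong_left)
  show "f i \<odot>\<^bsub>U\<^esub> B (fst i) (snd i) = \<zero>\<^bsub>U\<^esub>" if "i \<in> A - {p. f p \<noteq> 0}" for i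
    using that assms(3) U.lmult_0[simplified] by auto
  show "(\<lambda>p. f p \<odot>\<^bsub>U\<^esub> B (fst p) (snd p)) \<in> A \<rightarrow> carrier U"
    using assms(3) by auto
qed (use assms in auto)

lemma linear_extension_hom: "linear_extension \<in> module_hom scalars F U"
proof -
  have summand: "a \<odot>\<^bsub>U\<^esub> B (fst p) (snd p) \<in> carrier U" if "p \<in> carrier V \<times> carrier W" for p a
    using that by auto
  have 1: "linear_extension f \<in> carrier U" if "f \<in> carrier F" for f
    unfolding linear_extension_def using that summand by (intro U.finsum_closed) auto
  have 2: "linear_extension (\<lambda>p. f p + g p) = linear_extension f \<oplus>\<^bsub>U\<^esub> linear_extension g"
    if fg: "f \<in> carrier F" "g \<in> carrier F" for f g
  proof -
    let ?A = "{p. f p \<noteq> 0} \<union> {p. g p \<noteq> 0}"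
    have A: "finite ?A" "?A \<subseteq> carrier V \<times> carrier W"
      using fg by auto
    have "linear_extension (\<lambda>p. f p + g p)
        = (\<Oplus>\<^bsub>U\<^esub>p\<in>?A. (f p + g p) \<odot>\<^bsub>U\<^esub> B (fst p) (snd p))"
      by (rule linear_extension_superset[OF A(1) _ A(2)]) auto
    also have "\<dots> = (\<Oplus>\<^bsub>U\<^esub>p\<in>?A. f p \<odot>\<^bsub>U\<^esub> B (fst p) (snd p) \<oplus>\<^bsub>U\<^esub> g p \<odot>\<^bsub>U\<^esub> B (fst p) (snd p))"
      by (rule U.finsum_cong') (use A(2) U.smult_l_distr[simplified] in auto)
    also have "\<dots> = (\<Oplus>\<^bsub>U\<^esub>p\<in>?A. f p \<odot>\<^bsub>U\<^esub> B (fst p) (snd p))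
        \<oplus>\<^bsub>U\<^esub> (\<Oplus>\<^bsub>U\<^esub>p\<in>?A. g p \<odot>\<^bsub>U\<^esub> B (fst p) (snd p))"
      by (rule U.finsum_addf) (use A(2) in auto)
    also have "\<dots> = linear_extension f \<oplus>\<^bsub>U\<^esub> linear_extension g"
      using linear_extension_superset[OF A(1) _ A(2), of f]
        linear_extension_superset[OF A(1) _ A(2), of g] by auto
    finally show ?thesis .
  qed
  have 3: "linear_extension (\<lambda>p. a * f p) = a \<odot>\<^bsub>U\<^esub> linear_extension f"
    if f: "f \<in> carrier F" for f a
  proof -
    let ?A = "{p. f p \<noteq> 0}"
    have A: "finite ?A" "?A \<subseteq> carrier V \<times> carrier W"
      using f by auto
    have "linear_extension (\<lambda>p. a * f p)
        = (\<Oplus>\<^bsub>U\<^esub>p\<in>?A. (a * f p) \<odot>\<^bsub>U\<^esub> B (fst p) (snd p))"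
      by (rule linear_extension_superset[OF A(1) _ A(2)]) auto
    also have "\<dots> = (\<Oplus>\<^bsub>U\<^esub>p\<in>?A. a \<odot>\<^bsub>U\<^esub> (f p \<odot>\<^bsub>U\<^esub> B (fst p) (snd p)))"
      by (rule U.finsum_cong') (use A(2) U.smult_assoc1[simplified] in auto)
    also have "\<dots> = a \<odot>\<^bsub>U\<^esub> linear_extension f"
      unfolding linear_extension_def
      by (rule U.finsum_smult_ldistr[symmetric]) (use A in auto)
    finally show ?thesis .
  qed
  show ?thesis
    unfolding module_hom_def using 1 2 3 by (auto simp del: free_module_simps(1))
qed

lemma linear_extension_free_gen:
  assumes "v \<in> carrier V" "w \<in> carrier W"
  shows "linear_extension (free_gen (v, w)) = B v w"
proof -
  have "linear_extension (free_gen (v, w))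
      = (\<Oplus>\<^bsub>U\<^esub>p\<in>{(v, w)}. free_gen (v, w) p \<odot>\<^bsub>U\<^esub> B (fst p) (snd p))"
    by (rule linear_extension_superset) (use assms in \<open>auto simp: free_gen_def\<close>)
  also have "\<dots> = B v w"
    using assms U.smult_one[simplified] by (simp add: free_gen_def)
  finally show ?thesis .
qed

lemma F_module: "module scalars F"
  by (rule module_free_module)

interpretation E: mod_hom scalars F U linear_extension
  by (intro mod_hom.intro mod_hom_axioms.intro F_module U.module_axioms linear_extension_hom)

lemma gen_in_F:
  "\<lbrakk>v \<in> carrier V; w \<in> carrier W\<rbrakk> \<Longrightarrow> free_gen (v, w) \<in> carrier F"
  by (rule free_gen_in_free_module) simp

text \<open>Each bilinear relation is an iterated difference of this form, with \<open>a = 1\<close> or with \<open>a\<close> the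
  scalar that is pulled out.\<close>

lemma linear_extension_comb:
  assumes "f \<in> carrier F" "g \<in> carrier F"
  shows "(\<lambda>p. f p - a * g p) \<in> carrier F"
    and "linear_extension (\<lambda>p. f p - a * g p)
      = linear_extension f \<oplus>\<^bsub>U\<^esub> (- a) \<odot>\<^bsub>U\<^esub> linear_extension g"
proof -
  have *: "(\<lambda>p. f p - a * g p) = f \<oplus>\<^bsub>F\<^esub> (- a) \<odot>\<^bsub>F\<^esub> g"
    by (simp add: fun_eq_iff)
  show "(\<lambda>p. f p - a * g p) \<in> carrier F"
    unfolding * using assms by (simp del: free_module_simps)
  show "linear_extension (\<lambda>p. f p - a * g p)
      = linear_extension f \<oplus>\<^bsub>U\<^esub> (- a) \<odot>\<^bsub>U\<^esub> linear_extension g"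
    unfolding * using assms by (simp del: free_module_simps)
qed

lemma smult_uminus: "x \<in> carrier U \<Longrightarrow> (- a) \<odot>\<^bsub>U\<^esub> x = \<ominus>\<^bsub>U\<^esub> (a \<odot>\<^bsub>U\<^esub> x)"
  using U.smult_l_minus[of a x] by simp

lemma bilinear_relations_subset_ker: "bilinear_relations V W \<subseteq> E.ker"
proof -
  note comb1 = linear_extension_comb[where a = 1, simplified mult_1]
  note simps = comb1 linear_extension_comb gen_in_F linear_extension_free_gen smult_uminus
    add_left add_right smult_left smult_right U.smult_one[simplified]
  have r: "x \<oplus>\<^bsub>U\<^esub> y \<oplus>\<^bsub>U\<^esub> \<ominus>\<^bsub>U\<^esub> x \<oplus>\<^bsub>U\<^esub> \<ominus>\<^bsub>U\<^esub> y = \<zero>\<^bsub>U\<^esub>"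
    if "x \<in> carrier U" "y \<in> carrier U" for x y
    using that U.r_neg[of "x \<oplus>\<^bsub>U\<^esub> y"] by (simp add: U.minus_add U.a_assoc)
  show ?thesis
    unfolding bilinear_relations_def E.ker_def
    by (auto simp: simps r U.r_neg simp del: free_module_simps)
qed

lemma tensor_kernel_subset_ker: "tensor_kernel V W \<subseteq> E.ker"
  unfolding tensor_kernel_def
  by (rule module.span_is_subset[OF F_module bilinear_relations_subset_ker E.ker_is_submodule])

lemma bilinear_relations_in_free_module: "bilinear_relations V W \<subseteq> carrier F"
  using bilinear_relations_subset_ker by (auto simp: E.ker_def)

lemma submodule_tensor_kernel: "submodule scalars (tensor_kernel V W) F"
  unfolding tensor_kernel_def
  by (rule module.span_is_submodule[OF F_module bilinear_relations_in_free_module])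

text \<open>The lift evaluates a representative picked by choice. It differs from \<open>f\<close> by an element of the
  kernel, on which the linear extension vanishes.\<close>

lemma tensor_lift_quotient_proj:
  assumes "f \<in> carrier F"
  shows "tensor_lift U B (quotient_proj F (tensor_kernel V W) f) = linear_extension f"
proof -
  let ?t = "quotient_proj F (tensor_kernel V W) f"
  define g where "g = (SOME g. g \<in> ?t)"
  have "f \<in> ?t"
    by (rule quotient_proj_self[OF F_module submodule_tensor_kernel assms])
  then have "g \<in> ?t"
    unfolding g_def by (rule someI[where P = "\<lambda>g. g \<in> ?t"])
  then obtain r where r: "r \<in> tensor_kernel V W" "g = r \<oplus>\<^bsub>F\<^esub> f"
    by (auto simp: quotient_proj_mem[OF F_module submodule_tensor_kernel])
  then have "r \<in> carrier F" "linear_extension r = \<zero>\<^bsub>U\<^esub>"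
    using tensor_kernel_subset_ker by (auto simp: E.ker_def)
  then have "linear_extension g = linear_extension f"
    unfolding r(2) using assms by (simp del: free_module_simps)
  then show ?thesis
    by (simp add: tensor_lift_def g_def linear_extension_def Let_def)
qed

lemma tensor_lift_hom: "tensor_lift U B \<in> module_hom scalars (tensor V W) U"
  unfolding module_hom_def tensor_def
  by (auto simp: quotient_carrier tensor_lift_quotient_proj
      simp flip: quotient_proj_add[OF F_module submodule_tensor_kernel]
        quotient_proj_smult[OF F_module submodule_tensor_kernel]
      simp del: free_module_simps)

lemma tensor_lift_tensor_elem:
  "\<lbrakk>v \<in> carrier V; w \<in> carrier W\<rbrakk> \<Longrightarrow> tensor_lift U B (tensor_elem V W v w) = B v w"
  by (simp add: tensor_elem_def tensor_lift_quotient_proj gen_in_F linear_extension_free_gen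
      del: free_module_simps)

end

context
  fixes V :: "('k::field, 'a, 'm) module_scheme" and W :: "('k, 'b, 'n) module_scheme"
  assumes V: "module scalars V" and W: "module scalars W"
begin

interpretation V: module scalars V by (rule V)
interpretation W: module scalars W by (rule W)

\<comment> \<open>The facts about \<open>tensor_kernel\<close> above live in the locale of a bilinear map but concern only \<open>V\<close>
  and \<open>W\<close>; the zero map makes them available here.\<close>
interpretation zero: bilinear_map V W V "\<lambda>_ _. \<zero>\<^bsub>V\<^esub>"
  by unfold_locales simp_all

lemma module_tensor: "module scalars (tensor V W)"
  unfolding tensor_def
  by (rule module_quotient_module[OF zero.F_module zero.submodule_tensor_kernel])

text \<open>The generators of the tensor product satisfy the bilinear laws because the difference of the
  two sides of each law is one of the relations that are divided out.\<close>

lemma bilinear_map_tensor_elem: "bilinear_map V W (tensor V W) (tensor_elem V W)"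
proof -
  interpret T: module scalars "tensor V W" by (rule module_tensor)
  let ?F = "free_module (carrier V \<times> carrier W) :: ('k, 'a \<times> 'b \<Rightarrow> 'k) module"
  let ?K = "tensor_kernel V W"
  let ?q = "quotient_proj ?F ?K"
  interpret F: module scalars ?F by (rule zero.F_module)
  note sub = zero.submodule_tensor_kernel
  have eq: "?q f = ?q g"
    if "(\<lambda>p. f p - g p) \<in> bilinear_relations V W" "g \<in> carrier ?F" for f g
  proof (rule quotient_proj_eqI[OF zero.F_module sub _ that(2)])
    have "(\<lambda>p. f p - g p) \<in> ?K"
      using that(1) F.in_own_span[OF zero.bilinear_relations_in_free_module]
      by (auto simp: tensor_kernel_def)
    moreover have "f = (\<lambda>p. f p - g p) \<oplus>\<^bsub>?F\<^esub> g"
      by (simp add: fun_eq_iff)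
    ultimately show "f \<in> ?q g"
      unfolding quotient_proj_mem[OF zero.F_module sub] by blast
  qed
  note gen = zero.gen_in_F
  note add = quotient_proj_add[OF zero.F_module sub, symmetric]
  note smult = quotient_proj_smult[OF zero.F_module sub, symmetric]
  show ?thesis
  proof (intro bilinear_map.intro bilinear_map_axioms.intro V W module_tensor)
    show "tensor_elem V W v w \<in> carrier (tensor V W)"
      if "v \<in> carrier V" "w \<in> carrier W" for v w
      using gen[OF that] by (simp add: tensor_elem_def tensor_def quotient_carrier del: free_module_simps)
    show "tensor_elem V W (v \<oplus>\<^bsub>V\<^esub> v') w
        = tensor_elem V W v w \<oplus>\<^bsub>tensor V W\<^esub> tensor_elem V W v' w"
      if "v \<in> carrier V" "v' \<in> carrier V" "w \<in> carrier W" for v v' w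
      unfolding tensor_elem_def tensor_def add[OF gen gen, OF that(1,3) that(2,3)]
    proof (rule eq)
      show "(\<lambda>p. free_gen (v \<oplus>\<^bsub>V\<^esub> v', w) p - (free_gen (v, w) \<oplus>\<^bsub>?F\<^esub> free_gen (v', w)) p)
          \<in> bilinear_relations V W"
        using that unfolding bilinear_relations_def by (simp add: diff_diff_eq[symmetric]) blast
    qed (intro F.a_closed gen that)
    show "tensor_elem V W v (w \<oplus>\<^bsub>W\<^esub> w')
        = tensor_elem V W v w \<oplus>\<^bsub>tensor V W\<^esub> tensor_elem V W v w'"
      if "v \<in> carrier V" "w \<in> carrier W" "w' \<in> carrier W" for v w w'
      unfolding tensor_elem_def tensor_def add[OF gen gen, OF that(1,2) that(1,3)]
    proof (rule eq)
      show "(\<lambda>p. free_gen (v, w \<oplus>\<^bsub>W\<^esub> w') p - (free_gen (v, w) \<oplus>\<^bsub>?F\<^esub> free_gen (v, w')) p)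
          \<in> bilinear_relations V W"
        using that unfolding bilinear_relations_def by (simp add: diff_diff_eq[symmetric]) blast
    qed (intro F.a_closed gen that)
    show "tensor_elem V W (a \<odot>\<^bsub>V\<^esub> v) w = a \<odot>\<^bsub>tensor V W\<^esub> tensor_elem V W v w"
      if "v \<in> carrier V" "w \<in> carrier W" for v w a
      unfolding tensor_elem_def tensor_def smult[OF gen, OF that]
    proof (rule eq)
      show "(\<lambda>p. free_gen (a \<odot>\<^bsub>V\<^esub> v, w) p - (a \<odot>\<^bsub>?F\<^esub> free_gen (v, w)) p)
          \<in> bilinear_relations V W"
        using that unfolding bilinear_relations_def by simp blast
    qed (intro F.smult_closed gen that, simp)
    show "tensor_elem V W v (a \<odot>\<^bsub>W\<^esub> w) = a \<odot>\<^bsub>tensor V W\<^esub> tensor_elem V W v w"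
      if "v \<in> carrier V" "w \<in> carrier W" for v w a
      unfolding tensor_elem_def tensor_def smult[OF gen, OF that]
    proof (rule eq)
      show "(\<lambda>p. free_gen (v, a \<odot>\<^bsub>W\<^esub> w) p - (a \<odot>\<^bsub>?F\<^esub> free_gen (v, w)) p)
          \<in> bilinear_relations V W"
        using that unfolding bilinear_relations_def by simp blast
    qed (intro F.smult_closed gen that, simp)
  qed
qed

end

section \<open>The canonical map of a module coalgebra\<close>

text \<open>The lift is linear also in the bilinear map that is lifted. This gives linearity of the
  canonical map in its second argument, where \<open>h\<close> varies inside the map \<open>a \<otimes> b \<mapsto> a \<otimes> bh\<close>.\<close>

lemma tensor_lift_add:
  assumes "bilinear_map V W U B" "bilinear_map V W U B'" "bilinear_map V W U B''"
    and sum: "\<And>v w. \<lbrakk>v \<in> carrier V; w \<in> carrier W\<rbrakk> \<Longrightarrow> B'' v w = B v w \<oplus>\<^bsub>U\<^esub> B' v w"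
    and t: "t \<in> carrier (tensor V W)"
  shows "tensor_lift U B'' t = tensor_lift U B t \<oplus>\<^bsub>U\<^esub> tensor_lift U B' t"
proof -
  interpret B: bilinear_map V W U B by fact
  interpret B': bilinear_map V W U B' by fact
  interpret B'': bilinear_map V W U B'' by fact
  obtain f where f: "f \<in> carrier B.F" "t = quotient_proj B.F (tensor_kernel V W) f"
    using t by (auto simp: tensor_def quotient_carrier)
  have "B''.linear_extension f = (\<Oplus>\<^bsub>U\<^esub>p\<in>{p. f p \<noteq> 0}.
      f p \<odot>\<^bsub>U\<^esub> B (fst p) (snd p) \<oplus>\<^bsub>U\<^esub> f p \<odot>\<^bsub>U\<^esub> B' (fst p) (snd p))"
    unfolding B''.linear_extension_def
    by (rule B.U.finsum_cong') (use f(1) in \<open>auto simp: sum subset_iff B.U.smult_r_distr\<close>)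
  also have "\<dots> = B.linear_extension f \<oplus>\<^bsub>U\<^esub> B'.linear_extension f"
    unfolding B.linear_extension_def B'.linear_extension_def
    by (rule B.U.finsum_addf) (use f(1) in auto)
  finally show ?thesis
    unfolding f(2) using f(1)
    by (simp add: B.tensor_lift_quotient_proj B'.tensor_lift_quotient_proj
        B''.tensor_lift_quotient_proj del: free_module_simps)
qed

lemma tensor_lift_smult:
  assumes "bilinear_map V W U B" "bilinear_map V W U B'"
    and scaled: "\<And>v w. \<lbrakk>v \<in> carrier V; w \<in> carrier W\<rbrakk> \<Longrightarrow> B' v w = a \<odot>\<^bsub>U\<^esub> B v w"
    and t: "t \<in> carrier (tensor V W)"
  shows "tensor_lift U B' t = a \<odot>\<^bsub>U\<^esub> tensor_lift U B t"
proof -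
  interpret B: bilinear_map V W U B by fact
  interpret B': bilinear_map V W U B' by fact
  obtain f where f: "f \<in> carrier B.F" "t = quotient_proj B.F (tensor_kernel V W) f"
    using t by (auto simp: tensor_def quotient_carrier)
  have "B'.linear_extension f = (\<Oplus>\<^bsub>U\<^esub>p\<in>{p. f p \<noteq> 0}. a \<odot>\<^bsub>U\<^esub> (f p \<odot>\<^bsub>U\<^esub> B (fst p) (snd p)))"
    unfolding B'.linear_extension_def
    by (rule B.U.finsum_cong')
      (use f(1) in \<open>auto simp: scaled subset_iff mult.commute simp flip: B.U.smult_assoc1[simplified]\<close>)
  also have "\<dots> = a \<odot>\<^bsub>U\<^esub> B.linear_extension f"
    unfolding B.linear_extension_def
    by (rule B.U.finsum_smult_ldistr[symmetric]) (use f(1) in auto)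
  finally show ?thesis
    unfolding f(2) using f(1)
    by (simp add: B.tensor_lift_quotient_proj B'.tensor_lift_quotient_proj
        del: free_module_simps)
qed

text \<open>A functional \<open>l\<close> on \<open>W\<close> induces the linear map \<open>v \<otimes> w \<mapsto> l(w) v\<close>. It detects that \<open>v \<otimes> w\<close> does not
  vanish when \<open>v \<noteq> 0\<close> and \<open>l(w) \<noteq> 0\<close>.\<close>

lemma tensor_elem_eq_zeroD:
  assumes "module scalars V" "module scalars W"
    and add: "\<And>w w'. \<lbrakk>w \<in> carrier W; w' \<in> carrier W\<rbrakk> \<Longrightarrow> l (w \<oplus>\<^bsub>W\<^esub> w') = l w + l w'"
    and smult: "\<And>a w. w \<in> carrier W \<Longrightarrow> l (a \<odot>\<^bsub>W\<^esub> w) = a * l w"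
    and v: "v \<in> carrier V" and w: "w \<in> carrier W"
    and zero: "tensor_elem V W v w = \<zero>\<^bsub>tensor V W\<^esub>"
  shows "l w \<odot>\<^bsub>V\<^esub> v = \<zero>\<^bsub>V\<^esub>"
proof -
  interpret V: module scalars V by fact
  interpret W: module scalars W by fact
  interpret B: bilinear_map V W V "\<lambda>v w. l w \<odot>\<^bsub>V\<^esub> v"
    by unfold_locales
      (simp_all add: add smult V.smult_l_distr[simplified] V.smult_r_distr mult.commute
        flip: V.smult_assoc1[simplified])
  interpret L: mod_hom scalars "tensor V W" V "tensor_lift V (\<lambda>v w. l w \<odot>\<^bsub>V\<^esub> v)"
    by (intro mod_hom.intro mod_hom_axioms.intro module_tensor assms B.tensor_lift_hom)
  show ?thesis
    using B.tensor_lift_tensor_elem[OF v w] by (simp add: zero)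
qed

context
  fixes H :: "('k::field, 'h, 'n) coalgebra_scheme"
    and C :: "('k, 'a, 'm) coalgebra_scheme"
    and act :: "'a \<Rightarrow> 'h \<Rightarrow> 'a"
  assumes modC: "right_module_coalgebra H C act" and modH: "module scalars H"
begin

interpretation C: right_module_coalgebra H C act by (rule modC)
interpretation H: module scalars H by (rule modH)
interpretation T: bilinear_map C C "tensor C C" "tensor_elem C C"
  by (rule bilinear_map_tensor_elem[OF C.module.module_axioms C.module.module_axioms])

lemma bilinear_map_act:
  assumes "h \<in> carrier H"
  shows "bilinear_map C C (tensor C C) (\<lambda>a b. tensor_elem C C a (act b h))"
  by unfold_locales
    (simp_all add: assms C.act_closed C.act_add_left C.act_smult_left T.add_left T.add_right
      T.smult_left T.smult_right)

lemma bilinear_map_galois: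
  "bilinear_map C H (tensor C C)
    (\<lambda>c h. tensor_map C C (\<lambda>x. x) (\<lambda>y. act y h) (comult C c))"
proof -
  let ?L = "\<lambda>h. tensor_lift (tensor C C) (\<lambda>a b. tensor_elem C C a (act b h))"
  have hom: "?L h \<in> module_hom scalars (tensor C C) (tensor C C)" if "h \<in> carrier H" for h
    by (rule bilinear_map.tensor_lift_hom[OF bilinear_map_act[OF that]])
  have comult: "comult C c \<in> carrier (tensor C C)" if "c \<in> carrier C" for c
    using module_hom_closed[OF C.comult_linear] that by blast
  show ?thesis
    unfolding tensor_map_def
  proof (unfold_locales)
    show "?L h (comult C c) \<in> carrier (tensor C C)" if "c \<in> carrier C" "h \<in> carrier H" for c h
      using module_hom_closed[OF hom] comult that by blast
    show "?L h (comult C (c \<oplus>\<^bsub>C\<^esub> d)) = ?L h (comult C c) \<oplus>\<^bsub>tensor C C\<^esub> ?L h (comult C d)"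
      if "c \<in> carrier C" "d \<in> carrier C" "h \<in> carrier H" for c d h
      using that by (simp add: module_hom_add[OF C.comult_linear] module_hom_add[OF hom] comult)
    show "?L h (comult C (a \<odot>\<^bsub>C\<^esub> c)) = a \<odot>\<^bsub>tensor C C\<^esub> ?L h (comult C c)"
      if "c \<in> carrier C" "h \<in> carrier H" for c h a
      using that by (simp add: module_hom_smult[OF C.comult_linear] module_hom_smult[OF hom] comult)
    show "?L (h \<oplus>\<^bsub>H\<^esub> k) (comult C c) = ?L h (comult C c) \<oplus>\<^bsub>tensor C C\<^esub> ?L k (comult C c)"
      if "c \<in> carrier C" "h \<in> carrier H" "k \<in> carrier H" for c h k
      by (rule tensor_lift_add[OF bilinear_map_act bilinear_map_act bilinear_map_act _ comult])
        (use that in \<open>simp_all add: C.act_add_right C.act_closed T.add_right\<close>)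
    show "?L (a \<odot>\<^bsub>H\<^esub> h) (comult C c) = a \<odot>\<^bsub>tensor C C\<^esub> ?L h (comult C c)"
      if "c \<in> carrier C" "h \<in> carrier H" for c h a
      by (rule tensor_lift_smult[OF bilinear_map_act bilinear_map_act _ comult])
        (use that in \<open>simp_all add: C.act_smult_right C.act_closed T.smult_right\<close>)
  qed
qed

text \<open>If \<open>h\<close> annihilates \<open>C\<close>, then \<open>can(c \<otimes> h) = c\<^sup>(\<^sup>1\<^sup>) \<otimes> c\<^sup>(\<^sup>2\<^sup>)h = 0\<close>, whereas \<open>c \<otimes> h \<noteq> 0\<close>. So the canonical
  map already fails to be injective, whatever its image is. The functional \<open>l\<close> witnesses \<open>h \<noteq> 0\<close>; it
  is a parameter because for operators an evaluation does the job, and no basis has to be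
  extended.\<close>

lemma not_hopf_galois_coextension_if_annihilator:
  assumes h: "h \<in> carrier H" and ann: "\<And>c. c \<in> carrier C \<Longrightarrow> act c h = \<zero>\<^bsub>C\<^esub>"
    and add: "\<And>x y. \<lbrakk>x \<in> carrier H; y \<in> carrier H\<rbrakk> \<Longrightarrow> l (x \<oplus>\<^bsub>H\<^esub> y) = l x + l y"
    and smult: "\<And>a x. x \<in> carrier H \<Longrightarrow> l (a \<odot>\<^bsub>H\<^esub> x) = a * l x"
    and "l h \<noteq> 0" and c: "c \<in> carrier C" "c \<noteq> \<zero>\<^bsub>C\<^esub>"
  shows "\<not> hopf_galois_coextension H C act"
proof
  interpret B: bilinear_map C H "tensor C C"
    "\<lambda>c h. tensor_map C C (\<lambda>x. x) (\<lambda>y. act y h) (comult C c)"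
    by (rule bilinear_map_galois)
  interpret CH: bilinear_map C H "tensor C H" "tensor_elem C H"
    by (rule bilinear_map_tensor_elem[OF C.module.module_axioms modH])
  interpret can: mod_hom scalars "tensor C H" "tensor C C" "galois_can C act"
    unfolding galois_can_def
    by (intro mod_hom.intro mod_hom_axioms.intro CH.U.module_axioms T.U.module_axioms B.tensor_lift_hom)
  have "galois_can C act (tensor_elem C H c h)
      = tensor_lift (tensor C C) (\<lambda>a b. tensor_elem C C a (act b h)) (comult C c)"
    using B.tensor_lift_tensor_elem[OF c(1) h] unfolding galois_can_def tensor_map_def .
  \<comment> \<open>On \<open>C \<times> C\<close> the map \<open>(a, b) \<mapsto> a \<otimes> bh\<close> is zero, hence equal to its own multiple by \<open>0\<close>.\<close>
  also have "\<dots> = 0 \<odot>\<^bsub>tensor C C\<^esub>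
      tensor_lift (tensor C C) (\<lambda>a b. tensor_elem C C a (act b h)) (comult C c)"
  proof (rule tensor_lift_smult[OF bilinear_map_act[OF h] bilinear_map_act[OF h]])
    fix a b assume ab: "a \<in> carrier C" "b \<in> carrier C"
    then show "tensor_elem C C a (act b h) = 0 \<odot>\<^bsub>tensor C C\<^esub> tensor_elem C C a (act b h)"
      using T.smult_right[of a "\<zero>\<^bsub>C\<^esub>" 0] by (simp add: ann)
  qed (use module_hom_closed[OF C.comult_linear] c in blast)
  also have "\<dots> = \<zero>\<^bsub>tensor C C\<^esub>"
    using B.closed[OF c(1) h] T.U.lmult_0[simplified] unfolding tensor_map_def by simp
  finally have "galois_can C act (tensor_elem C H c h) = galois_can C act \<zero>\<^bsub>tensor C H\<^esub>"
    by simp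
  moreover assume "hopf_galois_coextension H C act"
  then have "inj_on (galois_can C act) (carrier (tensor C H))"
    by (simp add: hopf_galois_coextension_def Let_def bij_betw_def)
  ultimately have "tensor_elem C H c h = \<zero>\<^bsub>tensor C H\<^esub>"
    using CH.closed[OF c(1) h] CH.U.zero_closed by (metis inj_onD)
  then have *: "l h \<odot>\<^bsub>C\<^esub> c = \<zero>\<^bsub>C\<^esub>"
    using tensor_elem_eq_zeroD[of C H l c h] C.module.module_axioms modH add smult c(1) h
    by blast
  have "c = (inverse (l h) * l h) \<odot>\<^bsub>C\<^esub> c"
    using \<open>l h \<noteq> 0\<close> c C.module.smult_one[simplified] by simp
  also have "\<dots> = inverse (l h) \<odot>\<^bsub>C\<^esub> (l h \<odot>\<^bsub>C\<^esub> c)"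
    by (rule C.module.smult_assoc1[simplified]) (use c in simp_all)
  also have "\<dots> = \<zero>\<^bsub>C\<^esub>"
    by (simp add: *)
  finally show False
    using c by simp
qed

end

section \<open>Smooth functions\<close>

lemma C_k_decreasing: "C_k (Suc m) f \<Longrightarrow> C_k m f"
proof (induction m arbitrary: f)
  case 0
  then show ?case
    by (auto intro!: differentiable_imp_continuous_on simp: differentiable_on_def
        intro: differentiable_at_withinI)
qed (simp only: C_k.simps, blast)

lemma C_k_Suc_I:
  assumes "\<And>x. (f has_derivative f' x) (at x)" "\<And>v. C_k m (\<lambda>x. f' x v)"
  shows "C_k (Suc m) f"
proof -
  have "frechet_derivative f (at x) = f' x" for x
    using frechet_derivative_at[OF assms(1)] by simp
  then show ?thesis
    using assms by (auto simp: differentiable_def)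
qed

lemma C_k_SucD:
  assumes "C_k (Suc m) f"
  shows "(f has_derivative frechet_derivative f (at x)) (at x)"
    and "C_k m (\<lambda>x. frechet_derivative f (at x) v)"
  using assms by (auto simp: frechet_derivative_works)

lemma smooth_has_derivative:
  "smooth f \<Longrightarrow> (f has_derivative frechet_derivative f (at x)) (at x)"
  unfolding smooth_def using C_k_SucD(1)[of 0 f] by blast

lemma smooth_frechet_derivative: "smooth f \<Longrightarrow> smooth (\<lambda>x. frechet_derivative f (at x) v)"
  unfolding smooth_def using C_k_SucD(2) by blast

\<comment> \<open>The successor step is applied through \<open>C_k_Suc_I\<close> and \<open>C_k_SucD\<close> instead of by rewriting:
  \<open>C_k_Suc_I\<close> allows an explicitly given derivative in place of the choice term \<open>frechet_derivative\<close>.\<close>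
declare C_k.simps(2) [simp del]

lemma C_k_const: "C_k m (\<lambda>_. c)"
proof (induction m arbitrary: c)
  case (Suc m)
  show ?case
    by (rule C_k_Suc_I[where f' = "\<lambda>_ _. 0"]) (auto intro: Suc)
qed simp

lemma C_k_bounded_linear: "bounded_linear f \<Longrightarrow> C_k m f"
proof (cases m)
  case (Suc n)
  assume "bounded_linear f"
  then show "C_k m f"
    unfolding Suc by (intro C_k_Suc_I[where f' = "\<lambda>_. f"] bounded_linear_imp_has_derivative C_k_const)
qed (auto intro: linear_continuous_on)

lemma smooth_bounded_linear: "bounded_linear f \<Longrightarrow> smooth f"
  by (simp add: smooth_def C_k_bounded_linear)

lemma C_k_add: "C_k m f \<Longrightarrow> C_k m g \<Longrightarrow> C_k m (\<lambda>x. f x + g x)"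
proof (induction m arbitrary: f g)
  case (Suc m)
  then show ?case
    by (intro C_k_Suc_I[where f' = "\<lambda>x v. frechet_derivative f (at x) v + frechet_derivative g (at x) v"])
      (auto intro!: has_derivative_add C_k_SucD)
qed (simp add: continuous_on_add)

lemma smooth_add: "smooth f \<Longrightarrow> smooth g \<Longrightarrow> smooth (\<lambda>x. f x + g x)"
  by (simp add: smooth_def C_k_add)

lemma smooth_const: "smooth (\<lambda>_. c)"
  by (simp add: smooth_def C_k_const)

lemma smooth_sum:
  "(\<And>i. i \<in> I \<Longrightarrow> smooth (f i)) \<Longrightarrow> smooth (\<lambda>x. \<Sum>i\<in>I. f i x)"
  by (induction I rule: infinite_finite_induct) (simp_all add: smooth_const smooth_add)

lemma C_k_bilinear:
  assumes "bounded_bilinear b"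
  shows "C_k m f \<Longrightarrow> C_k m g \<Longrightarrow> C_k m (\<lambda>x. b (f x) (g x))"
proof (induction m arbitrary: f g)
  case (Suc m)
  interpret bounded_bilinear b by fact
  show ?case
  proof (rule C_k_Suc_I)
    show "((\<lambda>x. b (f x) (g x)) has_derivative
        (\<lambda>v. b (f x) (frechet_derivative g (at x) v) + b (frechet_derivative f (at x) v) (g x))) (at x)" for x
      by (rule FDERIV) (use Suc.prems in \<open>auto intro: C_k_SucD\<close>)
    show "C_k m (\<lambda>x. b (f x) (frechet_derivative g (at x) v)
        + b (frechet_derivative f (at x) v) (g x))" for v
      using Suc.prems by (intro C_k_add Suc.IH C_k_SucD(2)) (simp_all only: C_k_decreasing)
  qed
qed (simp add: bounded_bilinear.continuous_on[OF assms])

lemma smooth_mult: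
  fixes f g :: "'a::euclidean_space \<Rightarrow> 'b::real_normed_algebra"
  shows "smooth f \<Longrightarrow> smooth g \<Longrightarrow> smooth (\<lambda>x. f x * g x)"
  by (simp add: smooth_def C_k_bilinear[OF bounded_bilinear_mult])

lemma smooth_inner:
  fixes f g :: "'a::euclidean_space \<Rightarrow> 'b::real_inner"
  shows "smooth f \<Longrightarrow> smooth g \<Longrightarrow> smooth (\<lambda>x. f x \<bullet> g x)"
  by (simp add: smooth_def C_k_bilinear[OF bounded_bilinear_inner])

section \<open>Smooth bump functions\<close>

text \<open>The classical flat function \<open>exp(-1/t)\<close> together with its multiples by powers of \<open>1/t\<close>. The powers
  are included because the family is then closed under differentiation up to linear
  combinations, so that smoothness of all its members follows by a single induction.\<close>

definition flat_exp :: "nat \<Rightarrow> real \<Rightarrow> real" where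
  "flat_exp k t = (if t \<le> 0 then 0 else (1 / t) ^ k * exp (- (1 / t)))"

lemma flat_exp_tendsto_0: "((\<lambda>t. flat_exp k t) \<longlongrightarrow> 0) (at 0)"
proof -
  have "((\<lambda>t. flat_exp k t) \<longlongrightarrow> 0) (at_right 0)"
  proof (rule Lim_transform_eventually)
    have "((\<lambda>x::real. x ^ k / exp x) \<longlongrightarrow> 0) at_top"
      by (rule tendsto_power_div_exp_0)
    then show "((\<lambda>t::real. (inverse t) ^ k / exp (inverse t)) \<longlongrightarrow> 0) (at_right 0)"
      by (rule filterlim_compose[OF _ filterlim_inverse_at_top_right])
    show "\<forall>\<^sub>F t in at_right 0. inverse t ^ k / exp (inverse t) = flat_exp k t"
      using eventually_at_right_less[of 0]
      by eventually_elim (simp add: flat_exp_def exp_minus divide_inverse)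
  qed
  moreover have "((\<lambda>t. flat_exp k t) \<longlongrightarrow> 0) (at_left 0)"
  proof (rule Lim_transform_eventually[OF tendsto_const])
    show "\<forall>\<^sub>F t in at_left 0. 0 = flat_exp k t"
      unfolding eventually_at_left_field by (auto simp: flat_exp_def intro!: exI[of _ "-1"])
  qed
  ultimately show ?thesis
    by (simp add: filterlim_split_at)
qed

text \<open>At the origin the difference quotient of the \<open>k\<close>-th function is the \<open>(k+1)\<close>-st function, which
  tends to \<open>0\<close>.\<close>

lemma flat_exp_has_derivative:
  "(flat_exp k has_real_derivative flat_exp (k + 2) t - real k * flat_exp (k + 1) t) (at t)"
proof -
  consider "t < 0" | "t = 0" | "t > 0" by linarith
  then show ?thesis
  proof cases
    case 1
    have "(flat_exp k has_real_derivative 0) (at t)"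
      by (rule DERIV_cong_ev[THEN iffD2, OF refl _ refl, of _ "\<lambda>_. 0"])
        (use 1 eventually_nhds_in_open[of "{..<0::real}" t] in \<open>auto simp: flat_exp_def elim!: eventually_mono\<close>)
    with 1 show ?thesis by (simp add: flat_exp_def)
  next
    case 2
    have "((\<lambda>h. (flat_exp k (0 + h) - flat_exp k 0) / h) \<longlongrightarrow> 0) (at 0)"
      using flat_exp_tendsto_0[of "Suc k"]
      by (rule Lim_transform_eventually)
        (auto simp: flat_exp_def eventually_at_filter)
    with 2 show ?thesis by (simp add: DERIV_def flat_exp_def)
  next
    case 3
    have inv: "((\<lambda>t. 1 / t) has_real_derivative - ((1 / t)\<^sup>2)) (at t)"
      using 3 by (auto intro!: derivative_eq_intros simp: power2_eq_square)
    have deriv: "((\<lambda>t. (1 / t) ^ k * exp (- (1 / t))) has_real_derivative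
        flat_exp (k + 2) t - real k * flat_exp (k + 1) t) (at t)"
      by (rule DERIV_cong[OF DERIV_mult[OF DERIV_power[OF inv, of k] DERIV_fun_exp[OF DERIV_minus[OF inv]]]])
        (cases k; use 3 in \<open>simp add: flat_exp_def power2_eq_square algebra_simps\<close>)
    have ev: "\<forall>\<^sub>F s in nhds t. (1 / s) ^ k * exp (- (1 / s)) = flat_exp k s"
      using eventually_nhds_in_open[of "{0::real<..}" t] 3
      by (auto simp: flat_exp_def elim!: eventually_mono)
    show ?thesis
      by (rule DERIV_cong_ev[OF refl ev refl, THEN iffD1, OF deriv])
  qed
qed

lemma C_k_flat_exp: "smooth q \<Longrightarrow> C_k m (\<lambda>x. flat_exp k (q x))"
proof (induction m arbitrary: k)
  case 0
  have "isCont (flat_exp k) t" for t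
    using flat_exp_has_derivative by (rule DERIV_isCont)
  moreover have "continuous_on UNIV q"
    using 0 unfolding smooth_def by (metis C_k.simps(1))
  ultimately show ?case
    by (simp add: continuous_on_eq_continuous_at isCont_o2)
next
  case (Suc m)
  let ?d = "\<lambda>t. flat_exp (k + 2) t - real k * flat_exp (k + 1) t"
  show ?case
  proof (rule C_k_Suc_I)
    show "((\<lambda>x. flat_exp k (q x)) has_derivative
        (\<lambda>v. ?d (q x) * frechet_derivative q (at x) v)) (at x)" for x
      using has_derivative_compose[OF smooth_has_derivative[OF Suc.prems]
        flat_exp_has_derivative[of k "q x", unfolded has_field_derivative_def]] by simp
    have "C_k m (\<lambda>x. frechet_derivative q (at x) v)" for v
      using smooth_frechet_derivative[OF Suc.prems] by (simp add: smooth_def)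
    moreover have "C_k m (\<lambda>x. ?d (q x))"
    proof -
      have "C_k m (\<lambda>x. (- real k) * flat_exp (k + 1) (q x))"
        by (rule C_k_bilinear[OF bounded_bilinear_mult C_k_const Suc.IH[OF Suc.prems]])
      from C_k_add[OF Suc.IH[OF Suc.prems, of "k + 2"] this] show ?thesis by simp
    qed
    ultimately show "C_k m (\<lambda>x. ?d (q x) * frechet_derivative q (at x) v)" for v
      by (intro C_k_bilinear[OF bounded_bilinear_mult])
  qed
qed

text \<open>The flat function of \<open>r\<^sup>2 - |x - a|\<^sup>2\<close>.\<close>

lemma smooth_bump_function:
  fixes a :: "'a::euclidean_space"
  assumes "r > 0"
  obtains g :: "'a \<Rightarrow> complex" where "smooth g" "g a \<noteq> 0" "\<And>x. x \<notin> cball a r \<Longrightarrow> g x = 0"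
proof
  let ?q = "\<lambda>x. r\<^sup>2 - (x - a) \<bullet> (x - a)"
  have "smooth (\<lambda>x. x - a)"
    using smooth_add[OF smooth_bounded_linear[OF bounded_linear_ident] smooth_const[of "- a"]] by simp
  then have "smooth (\<lambda>x. r\<^sup>2 + (- 1) * ((x - a) \<bullet> (x - a)))"
    by (intro smooth_add smooth_const smooth_mult smooth_inner)
  then have q: "smooth ?q" by simp
  have "smooth (\<lambda>x. flat_exp 0 (?q x) *\<^sub>R (1::complex))"
    using C_k_flat_exp[OF q] by (simp add: smooth_def C_k_bilinear[OF bounded_bilinear_scaleR] C_k_const)
  then show "smooth (\<lambda>x. complex_of_real (flat_exp 0 (?q x)))"
    by (simp add: scaleR_conv_of_real)
  show "complex_of_real (flat_exp 0 (?q a)) \<noteq> 0"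
    using assms by (simp add: flat_exp_def)
  show "complex_of_real (flat_exp 0 (?q x)) = 0" if "x \<notin> cball a r" for x
  proof -
    have "r < norm (x - a)" using that by (simp add: dist_norm norm_minus_commute)
    then have "r\<^sup>2 \<le> (norm (x - a))\<^sup>2" using assms by (intro power_mono) auto
    then show ?thesis by (simp add: flat_exp_def power2_norm_eq_inner)
  qed
qed

section \<open>Test functions on the frame bundle\<close>

lemma open_frame_bundle: "open (frame_bundle :: 'n::finite frame set)"
proof -
  have "open {p :: 'n frame. det (snd p) \<noteq> 0}"
    unfolding det_def by (intro open_Collect_neq continuous_intros)
  also have "{p :: 'n frame. det (snd p) \<noteq> 0} = frame_bundle"
    by (auto simp: frame_bundle_def invertible_det_nz)
  finally show ?thesis .
qed

lemma ex_nonzero_test_function: "\<exists>g \<in> test_functions :: ('n::finite frame \<Rightarrow> complex) set. \<exists>p. g p \<noteq> 0"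
proof -
  have "(0, mat 1) \<in> (frame_bundle :: 'n frame set)"
    by (simp add: frame_bundle_def invertible_det_nz)
  then obtain r where r: "r > 0" "cball (0, mat 1) r \<subseteq> (frame_bundle :: 'n frame set)"
    using open_frame_bundle open_contains_cball by blast
  obtain g :: "'n frame \<Rightarrow> complex" where "smooth g" "g (0, mat 1) \<noteq> 0"
    "\<And>p. p \<notin> cball (0, mat 1) r \<Longrightarrow> g p = 0"
    using smooth_bump_function[OF r(1)] by blast
  then show ?thesis
    using r(2) compact_cball unfolding test_functions_def by blast
qed

lemma X_field_apply:
  "X_field k g p = (\<Sum>\<mu>\<in>UNIV. complex_of_real (snd p $ \<mu> $ k)
     * frechet_derivative g (at p) (axis \<mu> 1, 0))"
  by (cases p) (simp add: X_field_def)

lemma smooth_X_field: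
  fixes g :: "'n::finite frame \<Rightarrow> complex"
  assumes "smooth g"
  shows "smooth (X_field k g)"
proof -
  have "bounded_linear (\<lambda>p :: 'n frame. complex_of_real (snd p $ \<mu> $ k))" for \<mu>
    by (intro bounded_linear_compose[OF bounded_linear_of_real]
        bounded_linear_compose[OF bounded_linear_vec_nth] bounded_linear_snd)
  then have "smooth (\<lambda>p. \<Sum>\<mu>\<in>UNIV. complex_of_real (snd p $ \<mu> $ k)
      * frechet_derivative g (at p) (axis \<mu> 1, 0))"
    by (intro smooth_sum smooth_mult smooth_bounded_linear smooth_frechet_derivative assms)
  then show ?thesis
    by (simp add: X_field_apply[abs_def])
qed

lemma frechet_derivative_outside_support:
  assumes "closed K" "\<And>p. p \<notin> K \<Longrightarrow> g p = 0" "p \<notin> K"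
  shows "frechet_derivative g (at p) = (\<lambda>_. 0)"
proof -
  have "(g has_derivative (\<lambda>_. 0)) (at p)"
    by (rule has_derivative_transform_within_open[of "\<lambda>_. 0" _ _ _ "- K"])
      (use assms in auto)
  then show ?thesis
    by (rule frechet_derivative_at[symmetric])
qed

lemma X_field_in_test_functions:
  assumes "g \<in> test_functions"
  shows "X_field k g \<in> test_functions"
proof -
  obtain K where K: "smooth g" "compact K" "K \<subseteq> frame_bundle" "\<And>p. p \<notin> K \<Longrightarrow> g p = 0"
    using assms by (auto simp: test_functions_def)
  have "X_field k g p = 0" if "p \<notin> K" for p
    using frechet_derivative_outside_support[OF compact_imp_closed[OF K(2)] K(4) that]
    by (simp add: X_field_apply)
  with K show ?thesis
    using smooth_X_field by (auto simp: test_functions_def)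
qed

text \<open>At a frame \<open>(x, y)\<close> the field \<open>X\<^sub>k\<close> moves the base point along the \<open>k\<close>-th frame vector and keeps the
  frame, so its integral curves are the straight lines \<open>t \<mapsto> (x + t y\<^sub>k, y)\<close>.\<close>

lemma X_field_eq_derivative_along_column:
  assumes "smooth g"
  shows "X_field k g (x, y) = frechet_derivative g (at (x, y)) (column k y, 0)"
proof -
  interpret D: bounded_linear "frechet_derivative g (at (x, y))"
    using smooth_has_derivative[OF assms] by (rule has_derivative_bounded_linear)
  have *: "(column k y, 0) = (\<Sum>\<mu>\<in>UNIV. y $ \<mu> $ k *\<^sub>R (axis \<mu> 1, 0))"
    by (simp add: prod_eq_iff fst_sum snd_sum column_def vec_eq_iff axis_def if_distrib
        cong: if_cong)
  show ?thesis
    unfolding * D.sum D.scaleR by (simp add: X_field_def scaleR_conv_of_real)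
qed

text \<open>Along an integral curve an eigenfunction with eigenvalue \<open>z\<close> is a multiple of \<open>exp(zt)\<close>. The curve
  is an unbounded line, because the columns of an invertible matrix do not vanish, so it leaves
  the compact support and the multiple is \<open>0\<close>.\<close>

lemma X_field_no_eigenfunction:
  fixes g :: "'n::finite frame \<Rightarrow> complex"
  assumes g: "g \<in> test_functions" and eigen: "\<And>p. X_field k g p = z * g p"
  shows "g p = 0"
proof -
  obtain K where K: "smooth g" "compact K" "K \<subseteq> frame_bundle" "\<And>p. p \<notin> K \<Longrightarrow> g p = 0"
    using g by (auto simp: test_functions_def)
  obtain x y where p: "p = (x, y)" by (cases p)
  show ?thesis
  proof (cases "invertible y")
    case False
    then have "p \<notin> K" using K(3) by (auto simp: p frame_bundle_def)
    then show ?thesis by (rule K(4))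
  next
    case True
    define c where "c = column k y"
    have "c \<noteq> 0"
      using True det_zero_column(1)[of k y] by (auto simp: c_def invertible_det_nz)
    define u where "u t = g (x + t *\<^sub>R c, y)" for t
    define w where "w t = exp (t *\<^sub>R (- z)) * u t" for t
    have u: "(u has_vector_derivative z * u t) (at t)" for t
    proof -
      have "((\<lambda>t. (x + t *\<^sub>R c, y)) has_derivative (\<lambda>h. (h *\<^sub>R c, 0))) (at t)"
        by (auto intro!: derivative_eq_intros)
      from has_derivative_compose[OF this smooth_has_derivative[OF K(1)]]
      have *: "(u has_derivative (\<lambda>h. frechet_derivative g (at (x + t *\<^sub>R c, y)) (h *\<^sub>R c, 0))) (at t)"
        by (simp add: u_def[abs_def])
      interpret D: bounded_linear "frechet_derivative g (at (x + t *\<^sub>R c, y))"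
        using smooth_has_derivative[OF K(1)] by (rule has_derivative_bounded_linear)
      have "frechet_derivative g (at (x + t *\<^sub>R c, y)) (h *\<^sub>R c, 0) = h *\<^sub>R (z * u t)" for h
        using D.scaleR[of h "(c, 0)"] eigen[of "(x + t *\<^sub>R c, y)"]
        by (simp add: X_field_eq_derivative_along_column[OF K(1)] u_def c_def)
      with * show ?thesis by (simp add: has_vector_derivative_def)
    qed
    have "(w has_vector_derivative 0) (at t)" for t
      using has_vector_derivative_mult[OF exp_scaleR_has_vector_derivative_right[of "- z" t UNIV] u[of t]]
      by (simp add: w_def[abs_def])
    then have "(w has_derivative (\<lambda>_. 0)) (at t)" for t
      by (simp add: has_vector_derivative_def)
    then have const: "w s = w t" for s t
      using has_derivative_zero_unique[of UNIV w s t] by simp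
    obtain b where b: "\<And>q. q \<in> K \<Longrightarrow> norm q \<le> b"
      using compact_imp_bounded[OF K(2)] by (auto simp: bounded_iff)
    \<comment> \<open>A time at which the curve has left the ball of radius \<open>b\<close> around the origin.\<close>
    define t where "t = (\<bar>b\<bar> + norm x + 1) / norm c"
    have "norm (t *\<^sub>R c) = \<bar>b\<bar> + norm x + 1"
      using \<open>c \<noteq> 0\<close> by (simp add: t_def)
    then have "\<bar>b\<bar> + 1 \<le> norm (x + t *\<^sub>R c)"
      using norm_triangle_ineq4[of "x + t *\<^sub>R c" x] by simp
    also have "\<dots> \<le> norm (x + t *\<^sub>R c, y)"
      by (simp add: norm_Pair real_sqrt_sum_squares_ge1)
    finally have "(x + t *\<^sub>R c, y) \<notin> K"
      using b[of "(x + t *\<^sub>R c, y)"] by auto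
    then have "w t = 0"
      by (simp add: w_def u_def K(4))
    then have "w 0 = 0"
      using const by metis
    then show ?thesis
      by (simp add: w_def u_def p)
  qed
qed

lemma X_field_add:
  assumes "smooth f" "smooth g"
  shows "X_field k (\<lambda>p. f p + g p) = (\<lambda>p. X_field k f p + X_field k g p)"
proof -
  have "frechet_derivative (\<lambda>p. f p + g p) (at p)
      = (\<lambda>v. frechet_derivative f (at p) v + frechet_derivative g (at p) v)" for p
    by (rule frechet_derivative_at[symmetric])
      (intro has_derivative_add smooth_has_derivative assms)
  then show ?thesis
    by (simp add: X_field_apply fun_eq_iff distrib_left sum.distrib)
qed

lemma X_field_cmult:
  assumes "smooth f"
  shows "X_field k (\<lambda>p. z * f p) = (\<lambda>p. z * X_field k f p)"
proof -
  have "frechet_derivative (\<lambda>p. z * f p) (at p) = (\<lambda>v. z * frechet_derivative f (at p) v)" for p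
    by (rule frechet_derivative_at[symmetric])
      (intro has_derivative_mult_right smooth_has_derivative assms)
  then show ?thesis
    by (simp add: X_field_apply fun_eq_iff sum_distrib_left mult_ac)
qed

section \<open>Polynomials in a horizontal vector field\<close>

lemma crossed_product_simps [simp]:
  "carrier crossed_product = {a. finite {\<phi>. a \<phi> \<noteq> (\<lambda>_. 0)} \<and>
    {\<phi>. a \<phi> \<noteq> (\<lambda>_. 0)} \<subseteq> diffeomorphisms \<and> (\<forall>\<phi>. a \<phi> \<in> test_functions)}"
  by (simp add: crossed_product_def)

lemma test_function_smooth: "g \<in> test_functions \<Longrightarrow> smooth g"
  by (simp add: test_functions_def)

lemma test_functions_add:
  assumes "f \<in> test_functions" "g \<in> test_functions"
  shows "(\<lambda>p. f p + g p) \<in> test_functions"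
proof -
  obtain K L where K: "compact K" "K \<subseteq> frame_bundle" "\<And>p. p \<notin> K \<Longrightarrow> f p = 0"
    and L: "compact L" "L \<subseteq> frame_bundle" "\<And>p. p \<notin> L \<Longrightarrow> g p = 0"
    using assms by (auto simp: test_functions_def)
  have "compact (K \<union> L)" "K \<union> L \<subseteq> frame_bundle" "\<forall>p. p \<notin> K \<union> L \<longrightarrow> f p + g p = 0"
    using K L by (auto intro: compact_Un)
  then show ?thesis
    using assms smooth_add unfolding test_functions_def by blast
qed

lemma test_functions_cmult:
  assumes "f \<in> test_functions"
  shows "(\<lambda>p. z * f p) \<in> test_functions"
proof -
  have "smooth (\<lambda>p. z * f p)"
    using assms by (intro smooth_mult smooth_const test_function_smooth)
  then show ?thesis
    using assms by (auto simp: test_functions_def)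
qed

lemma crossed_product_add:
  assumes "a \<in> carrier crossed_product" "b \<in> carrier crossed_product"
  shows "(\<lambda>\<phi> p. a \<phi> p + b \<phi> p) \<in> carrier crossed_product"
proof -
  have supp: "{\<phi>. (\<lambda>p. a \<phi> p + b \<phi> p) \<noteq> (\<lambda>_. 0)} \<subseteq> {\<phi>. a \<phi> \<noteq> (\<lambda>_. 0)} \<union> {\<phi>. b \<phi> \<noteq> (\<lambda>_. 0)}"
    by auto
  show ?thesis
    using assms supp finite_subset[OF supp] test_functions_add by (simp, blast)
qed

lemma crossed_product_cmult:
  assumes "a \<in> carrier crossed_product"
  shows "(\<lambda>\<phi> p. z * a \<phi> p) \<in> carrier crossed_product"
proof -
  have supp: "{\<phi>. (\<lambda>p. z * a \<phi> p) \<noteq> (\<lambda>_. 0)} \<subseteq> {\<phi>. a \<phi> \<noteq> (\<lambda>_. 0)}"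
    by auto
  show ?thesis
    using assms supp finite_subset[OF supp] test_functions_cmult by (simp, blast)
qed

lemma crossed_product_zero: "(\<lambda>_ _. 0) \<in> carrier crossed_product"
  using smooth_const by (auto simp: test_functions_def intro!: exI[of _ "{}"])

lemma cm_X_apply: "a \<in> carrier crossed_product \<Longrightarrow> cm_X k a = (\<lambda>\<phi>. X_field k (a \<phi>))"
  by (simp add: cm_X_def crossed_operator_def del: crossed_product_simps)

lemma cm_id_apply: "a \<in> carrier crossed_product \<Longrightarrow> cm_id a = a"
  by (simp add: cm_id_def crossed_operator_def del: crossed_product_simps)

lemma X_field_zero: "X_field k (\<lambda>_. 0) = (\<lambda>_. 0)"
  using X_field_cmult[OF smooth_const, of k 0 0] by simp

lemma cm_X_in_crossed_product:
  assumes "a \<in> carrier crossed_product"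
  shows "cm_X k a \<in> carrier crossed_product"
proof -
  have supp: "{\<phi>. X_field k (a \<phi>) \<noteq> (\<lambda>_. 0)} \<subseteq> {\<phi>. a \<phi> \<noteq> (\<lambda>_. 0)}"
    using X_field_zero by force
  show ?thesis
    unfolding cm_X_apply[OF assms]
    using assms supp finite_subset[OF supp] X_field_in_test_functions by (simp, blast)
qed

lemma cm_operators_zero: "(\<lambda>_ _ _. 0) \<in> cm_operators"
  using cm_operators.smult[OF cm_operators.id, of 0] by simp

text \<open>The operator \<open>q(X\<^sub>k)\<close>, in Horner form. The identity is \<open>cm_id\<close> rather than the identity function,
  because operators vanish outside the crossed product.\<close>

definition cm_X_poly :: "'n \<Rightarrow> complex poly \<Rightarrow> 'n::finite cm_op" where
  "cm_X_poly k q = fold_coeffs (\<lambda>c S a \<phi> p. c * cm_id a \<phi> p + cm_X k (S a) \<phi> p) q (\<lambda>_ _ _. 0)"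

lemma cm_X_zero: "cm_X k (\<lambda>_ _. 0) = (\<lambda>_ _. 0)"
  using cm_X_apply[OF crossed_product_zero] by (simp add: X_field_zero)

lemma cm_X_poly_0: "cm_X_poly k 0 = (\<lambda>_ _ _. 0)"
  by (simp add: cm_X_poly_def)

text \<open>\<open>fold_coeffs\<close> skips the step for the pair of a zero coefficient and the zero polynomial, which
  is harmless since \<open>X\<^sub>k\<close> maps \<open>0\<close> to \<open>0\<close>.\<close>

lemma cm_X_poly_pCons:
  "cm_X_poly k (pCons c q) = (\<lambda>a \<phi> p. c * cm_id a \<phi> p + cm_X k (cm_X_poly k q a) \<phi> p)"
proof (cases "c = 0 \<and> q = 0")
  case True
  then show ?thesis
    by (simp add: cm_X_poly_def cm_X_zero)
qed (auto simp: cm_X_poly_def)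

lemma cm_X_poly_in_cm_operators: "cm_X_poly k q \<in> cm_operators"
proof (induction q)
  case (pCons c q)
  show ?case
    using cm_operators.add[OF cm_operators.smult[OF cm_operators.id, of c]
        cm_operators.comp[OF cm_operators.gen_X[of k] pCons.IH]]
    by (simp add: cm_X_poly_pCons)
qed (simp add: cm_X_poly_0 cm_operators_zero)

lemma cm_X_poly_in_crossed_product:
  assumes "a \<in> carrier crossed_product"
  shows "cm_X_poly k q a \<in> carrier crossed_product"
proof (induction q)
  case (pCons c q)
  then show ?case
    unfolding cm_X_poly_pCons
    by (intro crossed_product_add crossed_product_cmult cm_X_in_crossed_product)
      (simp_all only: cm_id_apply assms)
qed (simp only: cm_X_poly_0 crossed_product_zero)

lemma cm_X_poly_outside: "a \<notin> carrier crossed_product \<Longrightarrow> cm_X_poly k q a = (\<lambda>_ _. 0)"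
  by (induction q)
    (simp_all add: cm_X_poly_0 cm_X_poly_pCons cm_X_zero cm_id_def crossed_operator_def
      del: crossed_product_simps)

lemma cm_X_add:
  assumes "a \<in> carrier crossed_product" "b \<in> carrier crossed_product"
  shows "cm_X k (\<lambda>\<phi> p. a \<phi> p + b \<phi> p) = (\<lambda>\<phi> p. cm_X k a \<phi> p + cm_X k b \<phi> p)"
  using assms
  by (simp add: cm_X_apply[OF assms(1)] cm_X_apply[OF assms(2)]
      cm_X_apply[OF crossed_product_add[OF assms]] X_field_add test_function_smooth)

lemma cm_X_cmult:
  assumes "a \<in> carrier crossed_product"
  shows "cm_X k (\<lambda>\<phi> p. z * a \<phi> p) = (\<lambda>\<phi> p. z * cm_X k a \<phi> p)"
  using assms
  by (simp add: cm_X_apply[OF assms]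
      cm_X_apply[OF crossed_product_cmult[OF assms]] X_field_cmult test_function_smooth)

lemma cm_X_poly_add:
  fixes k :: "'n::finite"
  shows "cm_X_poly k (q + r) = (\<lambda>a \<phi> p. cm_X_poly k q a \<phi> p + cm_X_poly k r a \<phi> p)"
proof (rule ext)
  fix a :: "'n crossed"
  show "cm_X_poly k (q + r) a = (\<lambda>\<phi> p. cm_X_poly k q a \<phi> p + cm_X_poly k r a \<phi> p)"
  proof (cases "a \<in> carrier crossed_product")
    case True
    show ?thesis
      by (induction q r rule: poly_induct2)
        (simp_all add: cm_X_poly_0 cm_X_poly_pCons cm_X_add cm_X_poly_in_crossed_product[OF True]
          algebra_simps del: crossed_product_simps)
  qed (simp add: cm_X_poly_outside)
qed

lemma cm_X_poly_smult:
  fixes k :: "'n::finite"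
  shows "cm_X_poly k (Polynomial.smult z q) = (\<lambda>a \<phi> p. z * cm_X_poly k q a \<phi> p)"
proof (rule ext)
  fix a :: "'n crossed"
  show "cm_X_poly k (Polynomial.smult z q) a = (\<lambda>\<phi> p. z * cm_X_poly k q a \<phi> p)"
  proof (cases "a \<in> carrier crossed_product")
    case True
    show ?thesis
      by (induction q)
        (simp_all add: cm_X_poly_0 cm_X_poly_pCons cm_X_cmult cm_X_poly_in_crossed_product[OF True]
          algebra_simps del: crossed_product_simps)
  qed (simp add: cm_X_poly_outside)
qed

text \<open>Over \<open>\<complex>\<close> the polynomial splits into linear factors, and each \<open>X\<^sub>k - z\<close> is injective because \<open>X\<^sub>k\<close> has no
  eigenfunctions with compact support. In particular the powers of \<open>X\<^sub>k\<close> are linearly independent,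
  so the algebra of operators is infinite dimensional.\<close>

lemma cm_X_poly_inj:
  assumes "q \<noteq> 0" "a \<in> carrier crossed_product" "cm_X_poly k q a = (\<lambda>_ _. 0)"
  shows "a = (\<lambda>_ _. 0)"
  using assms(1,3)
proof (induction "Polynomial.degree q" arbitrary: q)
  case 0
  then obtain c where "q = [:c:]" "c \<noteq> 0"
    by (metis degree_0_id pCons_eq_0_iff)
  with 0 show ?case
    by (simp add: cm_X_poly_pCons cm_X_poly_0 cm_X_zero cm_id_apply[OF assms(2)] fun_eq_iff)
next
  case (Suc n)
  then have "\<not> constant (poly q)"
    by (simp add: constant_degree)
  then obtain z where "poly q z = 0"
    using fundamental_theorem_of_algebra by blast
  then obtain r where r: "q = [:- z, 1:] * r"
    by (auto simp: poly_eq_0_iff_dvd)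
  define b where "b = cm_X_poly k r a"
  have b: "b \<in> carrier crossed_product"
    unfolding b_def by (rule cm_X_poly_in_crossed_product[OF assms(2)])
  have q: "q = Polynomial.smult (- z) r + pCons 0 r"
    by (simp add: r)
  have "cm_X_poly k q a \<phi> p = - z * b \<phi> p + cm_X k b \<phi> p" for \<phi> p
    unfolding q cm_X_poly_add cm_X_poly_smult cm_X_poly_pCons b_def by simp
  then have "cm_X k b \<phi> p = z * b \<phi> p" for \<phi> p
    unfolding Suc.prems(2) by (metis add_eq_0_iff minus_minus minus_mult_left)
  then have "X_field k (b \<phi>) p = z * b \<phi> p" for \<phi> p
    by (simp add: cm_X_apply[OF b])
  then have "b = (\<lambda>_ _. 0)"
    using X_field_no_eigenfunction[of "b \<phi>" k z for \<phi>] b by (simp add: fun_eq_iff)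
  moreover have "r \<noteq> 0" "Polynomial.degree r = n"
    using Suc by (auto simp: r degree_mult_eq simp del: mult_pCons_left)
  ultimately show ?case
    using Suc.hyps(1)[of r] by (simp add: b_def)
qed

lemma ex_nonzero_crossed: "\<exists>a \<in> carrier crossed_product :: 'n::finite crossed set. a \<noteq> (\<lambda>_ _. 0)"
proof -
  obtain g :: "'n frame \<Rightarrow> complex" and p where g: "g \<in> test_functions" "g p \<noteq> 0"
    using ex_nonzero_test_function by blast
  have "inv_into UNIV (\<lambda>x. x) = (\<lambda>x :: real ^ 'n. x)"
    using inv_id by (simp add: id_def)
  then have "(\<lambda>x. x) \<in> (diffeomorphisms :: (real ^ 'n \<Rightarrow> real ^ 'n) set)"
    by (simp add: diffeomorphisms_def smooth_bounded_linear[OF bounded_linear_ident] bij_betw_def)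
  moreover have "(\<lambda>_. 0) \<in> (test_functions :: ('n frame \<Rightarrow> complex) set)"
    using crossed_product_zero by simp
  moreover have "{\<phi>. crossed_elem g (\<lambda>x. x) \<phi> \<noteq> (\<lambda>_. 0)} \<subseteq> {\<lambda>x. x}"
    by (auto simp: crossed_elem_def)
  ultimately have "crossed_elem g (\<lambda>x. x) \<in> carrier crossed_product"
    using g(1) by (auto simp: crossed_elem_def finite_subset)
  moreover have "crossed_elem g (\<lambda>x. x) (\<lambda>x. x) p \<noteq> 0"
    using g(2) by (simp add: crossed_elem_def)
  ultimately show ?thesis
    by (metis (no_types))
qed

section \<open>An element of the Hopf algebra that annihilates a finite dimensional module\<close>

lemma cm_hopf_algebra_simps [simp]:
  "carrier cm_hopf_algebra = cm_operators"
  "\<zero>\<^bsub>cm_hopf_algebra\<^esub> = (\<lambda>_ _ _. 0)"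
  "S \<oplus>\<^bsub>cm_hopf_algebra\<^esub> T = (\<lambda>a \<phi> p. S a \<phi> p + T a \<phi> p)"
  "r \<odot>\<^bsub>cm_hopf_algebra\<^esub> T = (\<lambda>a \<phi> p. r * T a \<phi> p)"
  "S \<otimes>\<^bsub>cm_hopf_algebra\<^esub> T = S \<circ> T"
  "\<one>\<^bsub>cm_hopf_algebra\<^esub> = cm_id"
  by (simp_all add: cm_hopf_algebra_def cm_algebra_def module.extend_def coalgebra.fields_def)

lemma module_cm_hopf_algebra: "module scalars (cm_hopf_algebra :: (complex, 'n::finite cm_op) coalgebra)"
proof (rule module_criteria[OF cring_scalars])
  show "\<forall>T\<in>carrier (cm_hopf_algebra :: (complex, 'n cm_op) coalgebra).
      \<exists>S\<in>carrier cm_hopf_algebra. T \<oplus>\<^bsub>cm_hopf_algebra\<^esub> S = \<zero>\<^bsub>cm_hopf_algebra\<^esub>"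
  proof
    fix T :: "'n cm_op" assume "T \<in> carrier cm_hopf_algebra"
    then show "\<exists>S\<in>carrier cm_hopf_algebra. T \<oplus>\<^bsub>cm_hopf_algebra\<^esub> S = \<zero>\<^bsub>cm_hopf_algebra\<^esub>"
      using cm_operators.smult[of T "- 1"] by (intro bexI[of _ "\<lambda>a \<phi> p. - 1 * T a \<phi> p"]) auto
  qed
qed (auto simp: cm_operators_zero algebra_simps intro: cm_operators.add cm_operators.smult)

text \<open>The monomials have infinitely many images in a finite dimensional space, unless two of them
  coincide; either way there is a nontrivial linear relation.\<close>

lemma polynomial_map_not_injective:
  fixes f :: "'k::field poly \<Rightarrow> 'a" and V :: "('k, 'a, 'm) module_scheme"
  assumes V: "vectorspace scalars V" and fd: "vectorspace.fin_dim scalars V"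
    and closed: "\<And>q. f q \<in> carrier V"
    and add: "\<And>q r. f (q + r) = f q \<oplus>\<^bsub>V\<^esub> f r"
    and smult: "\<And>z q. f (Polynomial.smult z q) = z \<odot>\<^bsub>V\<^esub> f q"
  shows "\<exists>q. q \<noteq> 0 \<and> f q = \<zero>\<^bsub>V\<^esub>"
proof -
  interpret V: vectorspace scalars V by fact
  define v where "v i = f (Polynomial.monom 1 i)" for i
  have v: "v i \<in> carrier V" for i
    by (simp add: v_def closed)
  have f_monom: "f (Polynomial.monom z i) = z \<odot>\<^bsub>V\<^esub> v i" for z i
    by (simp add: v_def Polynomial.smult_monom flip: smult)
  have f_0: "f 0 = \<zero>\<^bsub>V\<^esub>"
    using smult[of 0 0] V.module.lmult_0[simplified] closed by simp
  show ?thesis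
  proof (cases "inj v")
    case False
    then obtain i j where ij: "i \<noteq> j" "v i = v j"
      by (auto simp: inj_def)
    let ?q = "Polynomial.monom 1 i + Polynomial.monom (- 1) j :: 'k poly"
    have "poly.coeff ?q i \<noteq> 0"
      using ij by simp
    then have "?q \<noteq> 0"
      by (metis coeff_0)
    moreover have "f ?q = 1 \<odot>\<^bsub>V\<^esub> v j \<oplus>\<^bsub>V\<^esub> (- 1) \<odot>\<^bsub>V\<^esub> v j"
      by (simp add: add f_monom ij)
    then have "f ?q = (1 + - 1) \<odot>\<^bsub>V\<^esub> v j"
      using V.module.smult_l_distr[of 1 "- 1" "v j"] v by (simp del: add.right_inverse)
    then have "f ?q = \<zero>\<^bsub>V\<^esub>"
      using V.module.lmult_0[simplified] v by simp
    ultimately show ?thesis by blast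
  next
    case True
    then have "infinite (range v)"
      by (simp add: finite_image_iff)
    moreover have "range v \<subseteq> carrier V"
      using v by blast
    ultimately have "V.module.lin_dep (range v)"
      using V.fin_dim_li_fin[OF fd] by blast
    then obtain A a w where A: "finite A" "A \<subseteq> range v" "V.module.lincomb a A = \<zero>\<^bsub>V\<^esub>"
      and w: "w \<in> A" "a w \<noteq> 0"
      by (auto simp: V.module.lin_dep_def)
    define I where "I = v -` A"
    have I: "finite I" "A = v ` I"
      using A True by (auto simp: I_def finite_vimageI)
    define q where "q = (\<Sum>i\<in>I. Polynomial.monom (a (v i)) i)"
    have "f (\<Sum>i\<in>J. Polynomial.monom (a (v i)) i) = (\<Oplus>\<^bsub>V\<^esub>i\<in>J. a (v i) \<odot>\<^bsub>V\<^esub> v i)"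
      if "finite J" for J
      using that by (induction J) (use v in \<open>auto simp: f_0 add f_monom V.module.M.finsum_insert\<close>)
    then have "f q = (\<Oplus>\<^bsub>V\<^esub>i\<in>I. a (v i) \<odot>\<^bsub>V\<^esub> v i)"
      using I(1) by (simp add: q_def)
    also have "\<dots> = V.module.lincomb a A"
      unfolding V.module.lincomb_def I(2)
      by (rule V.module.M.finsum_reindex[symmetric]) (use v True in \<open>auto intro: inj_on_subset\<close>)
    finally have "f q = \<zero>\<^bsub>V\<^esub>"
      using A(3) by simp
    moreover have "q \<noteq> 0"
    proof -
      from w I obtain i where i: "i \<in> I" "w = v i" by blast
      have "poly.coeff q i = (\<Sum>j\<in>I. if j = i then a (v j) else 0)"
        by (simp add: q_def coeff_sum)
      then have "poly.coeff q i \<noteq> 0"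
        using I(1) i w by simp
      then show ?thesis by (metis coeff_0)
    qed
    ultimately show ?thesis by blast
  qed
qed

text \<open>Injectivity of an operator on the crossed product, rather than just its being nonzero, is what
  survives composition.\<close>

definition faithful_operator :: "'n::finite cm_op \<Rightarrow> bool" where
  "faithful_operator T \<longleftrightarrow> (\<forall>a\<in>carrier crossed_product. T a \<in> carrier crossed_product \<and>
     (T a = (\<lambda>_ _. 0) \<longrightarrow> a = (\<lambda>_ _. 0)))"

context
  fixes C :: "(complex, 'c, 'm) coalgebra_scheme"
    and act :: "'c \<Rightarrow> 'n::finite cm_op \<Rightarrow> 'c"
  assumes modC: "right_module_coalgebra (cm_hopf_algebra :: (complex, 'n cm_op) coalgebra) C act"
    and fd: "vectorspace.fin_dim scalars C"
begin

interpretation C: right_module_coalgebra "cm_hopf_algebra :: (complex, 'n cm_op) coalgebra" C act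
  by (rule modC)

text \<open>The map \<open>q \<mapsto> c q(X\<^sub>k)\<close> from polynomials to \<open>C\<close> has a nonzero kernel. Any frame direction \<open>k\<close> will
  do.\<close>

lemma ex_faithful_operator_annihilating_vector:
  assumes c: "c \<in> carrier C"
  shows "\<exists>T\<in>cm_operators. faithful_operator T \<and> act c T = \<zero>\<^bsub>C\<^esub>"
proof -
  define k :: 'n where "k = undefined"
  note X = cm_X_poly_in_cm_operators[of k]
  have "\<exists>q. q \<noteq> 0 \<and> act c (cm_X_poly k q) = \<zero>\<^bsub>C\<^esub>"
  proof (rule polynomial_map_not_injective[OF C.vectorspace_axioms fd])
    show "act c (cm_X_poly k q) \<in> carrier C" for q
      using C.act_closed[OF c, simplified] X by blast
    show "act c (cm_X_poly k (q + r)) = act c (cm_X_poly k q) \<oplus>\<^bsub>C\<^esub> act c (cm_X_poly k r)" for q r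
      using C.act_add_right[OF c, simplified, OF X X] by (simp add: cm_X_poly_add)
    show "act c (cm_X_poly k (Polynomial.smult z q)) = z \<odot>\<^bsub>C\<^esub> act c (cm_X_poly k q)" for z q
      using C.act_smult_right[OF c, simplified, OF X] by (simp add: cm_X_poly_smult)
  qed
  then obtain q where q: "q \<noteq> 0" "act c (cm_X_poly k q) = \<zero>\<^bsub>C\<^esub>" by blast
  have "faithful_operator (cm_X_poly k q)"
    unfolding faithful_operator_def
    using cm_X_poly_in_crossed_product cm_X_poly_inj[OF q(1)] by blast
  with q X show ?thesis by blast
qed

lemma act_zero_left: "T \<in> cm_operators \<Longrightarrow> act \<zero>\<^bsub>C\<^esub> T = \<zero>\<^bsub>C\<^esub>"
  using C.act_smult_left[of "\<zero>\<^bsub>C\<^esub>" T 0] C.act_closed[of "\<zero>\<^bsub>C\<^esub>" T]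
  by (simp add: C.module.lmult_0[simplified])

text \<open>If \<open>T\<close> annihilates \<open>S\<close> and \<open>R\<close> annihilates \<open>cT\<close>, then \<open>TR\<close> annihilates \<open>S\<close> and \<open>c\<close>. Choosing \<open>R\<close> for \<open>cT\<close>
  instead of for \<open>c\<close> avoids commuting the two operators.\<close>

lemma ex_faithful_operator_annihilating_finite:
  assumes "finite S" "S \<subseteq> carrier C"
  shows "\<exists>T\<in>cm_operators. faithful_operator T \<and> (\<forall>c\<in>S. act c T = \<zero>\<^bsub>C\<^esub>)"
  using assms
proof (induction S)
  case empty
  have "faithful_operator (cm_id :: 'n cm_op)"
    by (simp add: faithful_operator_def cm_id_apply del: crossed_product_simps)
  then show ?case
    using cm_operators.id by blast
next
  case (insert c S)
  then obtain T where T: "T \<in> cm_operators" "faithful_operator T" "\<forall>d\<in>S. act d T = \<zero>\<^bsub>C\<^esub>"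
    by auto
  have "act c T \<in> carrier C"
    using C.act_closed[of c T] insert.prems T(1) by simp
  then obtain R where R: "R \<in> cm_operators" "faithful_operator R" "act (act c T) R = \<zero>\<^bsub>C\<^esub>"
    using ex_faithful_operator_annihilating_vector by blast
  have "act d (T \<circ> R) = act (act d T) R" if "d \<in> carrier C" for d
    using C.act_mult[of d T R] that T(1) R(1) by simp
  then have "\<forall>d\<in>insert c S. act d (T \<circ> R) = \<zero>\<^bsub>C\<^esub>"
    using insert.prems T R act_zero_left by auto
  moreover have "faithful_operator (T \<circ> R)"
    using T(2) R(2) unfolding faithful_operator_def comp_apply by blast
  ultimately show ?case
    using cm_operators.comp[OF T(1) R(1)] by blast
qed

lemma ex_faithful_operator_annihilating:
  "\<exists>T\<in>cm_operators. faithful_operator T \<and> (\<forall>c\<in>carrier C. act c T = \<zero>\<^bsub>C\<^esub>)"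
proof -
  obtain S where S: "finite S" "S \<subseteq> carrier C" "C.module.span S = carrier C"
    using fd unfolding C.fin_dim_def by blast
  from ex_faithful_operator_annihilating_finite[OF S(1,2)]
  obtain T where T: "T \<in> cm_operators" "faithful_operator T" "\<forall>c\<in>S. act c T = \<zero>\<^bsub>C\<^esub>"
    by blast
  have "(\<lambda>c. act c T) \<in> module_hom scalars C C"
    using T(1) C.act_closed C.act_add_left C.act_smult_left by (auto simp: module_hom_def)
  then interpret T: mod_hom scalars C C "\<lambda>c. act c T"
    by (intro mod_hom.intro mod_hom_axioms.intro C.module.module_axioms)
  have "C.module.span S \<subseteq> T.ker"
    by (rule C.module.span_is_subset[OF _ T.ker_is_submodule]) (use S T in \<open>auto simp: T.ker_def\<close>)
  then have "\<forall>c\<in>carrier C. act c T = \<zero>\<^bsub>C\<^esub>"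
    using S(3) by (auto simp: T.ker_def)
  with T show ?thesis by blast
qed

end

section \<open>Finite dimensional Hopf Galois coextensions\<close>

theorem proposition4p4:
  fixes C :: "(complex, 'c) coalgebra"
    and act :: "'c \<Rightarrow> 'n::finite cm_op \<Rightarrow> 'c"
  assumes "right_module_coalgebra (cm_hopf_algebra :: (complex, 'n cm_op) coalgebra) C act"
    and "cocommutative C"
    and "\<not> trivial_action (cm_hopf_algebra :: (complex, 'n cm_op) coalgebra) C act"
    and "vectorspace.fin_dim scalars C"
  shows "\<not> hopf_galois_coextension (cm_hopf_algebra :: (complex, 'n cm_op) coalgebra) C act"
proof -
  interpret C: right_module_coalgebra "cm_hopf_algebra :: (complex, 'n cm_op) coalgebra" C act
    by fact
  obtain c h where "c \<in> carrier C" "h \<in> carrier (cm_hopf_algebra :: (complex, 'n cm_op) coalgebra)"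
    "act c h \<noteq> counit cm_hopf_algebra h \<odot>\<^bsub>C\<^esub> c"
    using assms(3) by (auto simp: trivial_action_def)
  \<comment> \<open>On the zero space every action is trivial.\<close>
  then have "carrier C \<noteq> {\<zero>\<^bsub>C\<^esub>}"
    using C.act_closed[of c h] C.module.smult_closed[of "counit cm_hopf_algebra h" c] by auto
  then obtain d where d: "d \<in> carrier C" "d \<noteq> \<zero>\<^bsub>C\<^esub>"
    using C.module.M.zero_closed by blast
  obtain T where T: "T \<in> cm_operators" "faithful_operator T" "\<forall>c\<in>carrier C. act c T = \<zero>\<^bsub>C\<^esub>"
    using ex_faithful_operator_annihilating[OF assms(1,4)] by blast
  obtain a :: "'n crossed" where a: "a \<in> carrier crossed_product" "a \<noteq> (\<lambda>_ _. 0)"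
    using ex_nonzero_crossed by blast
  then have "T a \<noteq> (\<lambda>_ _. 0)"
    using T(2) unfolding faithful_operator_def by blast
  then obtain \<phi> p where p: "T a \<phi> p \<noteq> 0"
    by (auto simp: fun_eq_iff)
  show ?thesis
    by (rule not_hopf_galois_coextension_if_annihilator[OF assms(1) module_cm_hopf_algebra,
          where h = T and l = "\<lambda>h. h a \<phi> p" and c = d])
      (use T p d in auto)
qed

end
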